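(* Let $\Omega\subset\mathbb R^n$ be a smooth bounded domain, let $V$ be a potential on $\Omega$ and let $K$ be a compact set included in $\Omega$. Assume that $C^2_c(\Omega\setminus K)$ is weakly dense in $C^2_0(\overline\Omega)$ in the sense of the potential $V$, and let $w\in L^1(\Omega;V)\cap L^1_0(\Omega)$ be such that for all $\varphi\in C^2_c(\Omega\setminus K)$ $$\int_\Omega w(-\Delta\varphi+V\varphi)\,dx=0.$$ Then $w\equiv0$.
   Context: A potential on $\Omega$ is a measurable function $V:\Omega\to[0,+\infty]$ that is not identically zero (a.e.). $C^2_0(\overline\Omega)=\{\varphi\in C^2(\overline\Omega):\ \varphi=0\text{ on }\partial\Omega\}$. With $\delta(x)=\mathrm{dist}(x;\partial\Omega)$, $$L^1(\Omega;V)=L^1(V)=\Big\{g:\Omega\to\mathbb R\text{ measurable}:\ \int_\Omega|g|V\,dx<+\infty\Big\},\qquad L^1_0(\Omega)=\Big\{g\in L^1(\Omega):\ \lim_{\varepsilon\to0}\frac1\varepsilon\int_{\{\delta\le\varepsilon\}}|g|\,dx=0\Big\}.$$ A sequence $(\varphi_j)_j$ of $C^2_0(\overline\Omega)$ converges weakly to $\phi\in C^2_0(\overline\Omega)$ in the sense of the potential $V$ if for all $g\in L^1(V)\cap L^1_0(\Omega)$, as $j\to+\infty$: $\int_\Omega g\varphi_jV\,dx\to\int_\Omega g\phi V\,dx$; $\int_\Omega g\,\partial_k\varphi_j\,dx\to\int_\Omega g\,\partial_k\phi\,dx$ for $k=1,\dots,n$; and $\int_\Omega g\Delta\varphi_j\,dx\to\int_\Omega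 g\Delta\phi\,dx$. $C^2_c(\Omega\setminus K)$ is weakly dense in $C^2_0(\overline\Omega)$ in the sense of $V$ if every $\phi\in C^2_0(\overline\Omega)$ is the weak limit, in the sense of $V$, of a sequence in $C^2_c(\Omega\setminus K)$. *)

theory Defs
  imports "HOL-Analysis.Analysis"
begin

definition partial_deriv :: "'n::finite \<Rightarrow> (real^'n \<Rightarrow> real) \<Rightarrow> real^'n \<Rightarrow> real" where
  "partial_deriv k f x = frechet_derivative f (at x) (axis k 1)"

definition laplacian :: "(real^'n::finite \<Rightarrow> real) \<Rightarrow> real^'n \<Rightarrow> real" where
  "laplacian f x = (\<Sum>k\<in>UNIV. partial_deriv k (partial_deriv k f) x)"

text \<open>Only used for open \<open>U\<close>, where it is the usual class \<open>C\<^sup>m(U)\<close>: a function is of class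
  \<open>C\<^sup>m\<^sup>+\<^sup>1\<close> iff it is differentiable with all first order partial derivatives of class
  \<open>C\<^sup>m\<close>.\<close>

primrec Ck_on :: "nat \<Rightarrow> (real^'n::finite \<Rightarrow> real) \<Rightarrow> (real^'n) set \<Rightarrow> bool" where
  "Ck_on 0 f U \<longleftrightarrow> continuous_on U f"
| "Ck_on (Suc m) f U \<longleftrightarrow> f differentiable_on U \<and> (\<forall>k. Ck_on m (partial_deriv k f) U)"

definition extends_continuously_to_closure :: "(real^'n::finite) set \<Rightarrow> (real^'n \<Rightarrow> real) \<Rightarrow> bool" where
  "extends_continuously_to_closure \<Omega> f \<longleftrightarrow>
     (\<exists>g. continuous_on (closure \<Omega>) g \<and> (\<forall>x\<in>\<Omega>. g x = f x))"

text \<open>The boundary is smooth: near each boundary point, \<open>\<Omega>\<close> is the sublevel set of a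
  \<open>C\<^sup>\<infinity>\<close> defining function \<open>\<rho>\<close> with nonvanishing gradient. It follows that the boundary is
  locally \<open>{\<rho> = 0}\<close> and that \<open>\<Omega>\<close> lies on one side of it.\<close>

definition smooth_bounded_domain :: "(real^'n::finite) set \<Rightarrow> bool" where
  "smooth_bounded_domain \<Omega> \<longleftrightarrow>
     open \<Omega> \<and> connected \<Omega> \<and> \<Omega> \<noteq> {} \<and> bounded \<Omega> \<and>
     (\<forall>p\<in>frontier \<Omega>. \<exists>U \<rho>. open U \<and> p \<in> U \<and> (\<forall>m. Ck_on m \<rho> U) \<and>
        (\<forall>x\<in>U. \<exists>k. partial_deriv k \<rho> x \<noteq> 0) \<and>
        \<Omega> \<inter> U = {x\<in>U. \<rho> x < 0})"

text \<open>Functions on \<open>\<Omega>\<close> or its closure are total functions on the whole space whose values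
  elsewhere are irrelevant. \<open>C\<^sup>2\<close> up to the boundary means that the function and its
  derivatives of order at most 2 in \<open>\<Omega>\<close> extend continuously to the closure; the function itself
  carries its boundary values.\<close>

definition C2_closure :: "(real^'n::finite) set \<Rightarrow> (real^'n \<Rightarrow> real) set" where
  "C2_closure \<Omega> = {\<phi>. Ck_on 2 \<phi> \<Omega> \<and> continuous_on (closure \<Omega>) \<phi> \<and>
     (\<forall>k. extends_continuously_to_closure \<Omega> (partial_deriv k \<phi>)) \<and>
     (\<forall>k l. extends_continuously_to_closure \<Omega> (partial_deriv k (partial_deriv l \<phi>)))}"

definition C2_0 :: "(real^'n::finite) set \<Rightarrow> (real^'n \<Rightarrow> real) set" where
  "C2_0 \<Omega> = {\<phi> \<in> C2_closure \<Omega>. \<forall>x\<in>frontier \<Omega>. \<phi> x = 0}"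

text \<open>\<open>C\<^sup>2\<close> functions with compact support in the open set \<open>U\<close>, extended by zero outside
  \<open>U\<close>.\<close>

definition C2_c :: "(real^'n::finite) set \<Rightarrow> (real^'n \<Rightarrow> real) set" where
  "C2_c U = {\<phi>. Ck_on 2 \<phi> U \<and> compact (closure {x. \<phi> x \<noteq> 0}) \<and> closure {x. \<phi> x \<noteq> 0} \<subseteq> U}"

definition potential :: "(real^'n::finite) set \<Rightarrow> (real^'n \<Rightarrow> ennreal) \<Rightarrow> bool" where
  "potential \<Omega> V \<longleftrightarrow> V \<in> borel_measurable (lebesgue_on \<Omega>) \<and>
     \<not> (AE x in lebesgue_on \<Omega>. V x = 0)"

definition L1_V :: "(real^'n::finite) set \<Rightarrow> (real^'n \<Rightarrow> ennreal) \<Rightarrow> (real^'n \<Rightarrow> real) set" where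
  "L1_V \<Omega> V = {g \<in> borel_measurable (lebesgue_on \<Omega>).
     (\<integral>\<^sup>+ x. ennreal \<bar>g x\<bar> * V x \<partial>lebesgue_on \<Omega>) < \<infinity>}"

definition L1_0 :: "(real^'n::finite) set \<Rightarrow> (real^'n \<Rightarrow> real) set" where
  "L1_0 \<Omega> = {g. integrable (lebesgue_on \<Omega>) g \<and>
     ((\<lambda>\<epsilon>. 1 / \<epsilon> * (LINT x|lebesgue_on {x\<in>\<Omega>. infdist x (frontier \<Omega>) \<le> \<epsilon>}. \<bar>g x\<bar>))
        \<longlongrightarrow> 0) (at_right 0)}"

text \<open>Since \<open>enn2real \<infinity> = 0\<close>, the integrands \<open>g \<phi> V\<close> below are set to zero where \<open>V\<close> is
  infinite. This agrees with the convention \<open>0 \<cdot> \<infinity> = 0\<close>: every \<open>g \<in> L1_V \<Omega> V\<close> vanishes almost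
  everywhere on that set.\<close>

definition weakly_converges ::
  "(real^'n::finite) set \<Rightarrow> (real^'n \<Rightarrow> ennreal) \<Rightarrow> (nat \<Rightarrow> real^'n \<Rightarrow> real) \<Rightarrow> (real^'n \<Rightarrow> real) \<Rightarrow> bool"
  where
  "weakly_converges \<Omega> V \<phi>s \<phi> \<longleftrightarrow> (\<forall>g \<in> L1_V \<Omega> V \<inter> L1_0 \<Omega>.
     ((\<lambda>j. LINT x|lebesgue_on \<Omega>. g x * \<phi>s j x * enn2real (V x))
        \<longlonglongrightarrow> (LINT x|lebesgue_on \<Omega>. g x * \<phi> x * enn2real (V x))) \<and>
     (\<forall>k. (\<lambda>j. LINT x|lebesgue_on \<Omega>. g x * partial_deriv k (\<phi>s j) x)
        \<longlonglongrightarrow> (LINT x|lebesgue_on \<Omega>. g x * partial_deriv k \<phi> x)) \<and>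
     ((\<lambda>j. LINT x|lebesgue_on \<Omega>. g x * laplacian (\<phi>s j) x)
        \<longlonglongrightarrow> (LINT x|lebesgue_on \<Omega>. g x * laplacian \<phi> x)))"

definition weakly_dense ::
  "(real^'n::finite) set \<Rightarrow> (real^'n \<Rightarrow> ennreal) \<Rightarrow> (real^'n \<Rightarrow> real) set \<Rightarrow> bool" where
  "weakly_dense \<Omega> V D \<longleftrightarrow>
     (\<forall>\<phi> \<in> C2_0 \<Omega>. \<exists>\<phi>s. (\<forall>j. \<phi>s j \<in> D) \<and> weakly_converges \<Omega> V \<phi>s \<phi>)"

end

theory Submission
  imports Defs
begin

text \<open>
  Testing the weak convergence \<open>\<phi>\<^sub>j \<rightarrow> \<phi>\<close> against \<open>g = w\<close> shows that the equation for \<open>w\<close> extends from functions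
  with support in \<open>\<Omega> - K\<close> to all \<open>\<phi>\<close> in \<open>C2_0 \<Omega>\<close>, in particular to those with compact support in \<open>\<Omega>\<close>. So
  \<open>\<Delta> w = V w\<close> holds in \<open>\<Omega>\<close> in the weak sense, the compact set \<open>K\<close> has disappeared, and the claim is
  uniqueness for the Schroedinger equation with zero boundary values.

  As \<open>V w\<close> has the sign of \<open>w\<close>, Kato's inequality (\<open>kato_inequality\<close>) makes \<open>\<bar>w\<bar>\<close> weakly subharmonic. It is
  derived from the corresponding statement for difference quotients, which is an elementary pointwise
  inequality (\<open>second_diff_abs\<close>), applied to mollifications of \<open>w\<close>. Nonlinear functions of \<open>w\<close> are never
  differentiated and integration by parts reduces to translation invariance.

  Finally, a nonnegative subharmonic function with the zero trace condition of \<open>L1_0 \<Omega>\<close> vanishes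
  (\<open>subharmonic_zero_trace_imp_zero\<close>). This avoids solving a Dirichlet problem in \<open>\<Omega>\<close>: the function \<open>R\<^sup>2 - \<bar>x\<bar>\<^sup>2\<close>
  is superharmonic with constant Laplacian, and it becomes a test function after multiplication by
  \<open>F (\<psi>)\<close>, where \<open>\<psi>\<close> replaces the distance to the boundary (\<open>exists_barrier\<close>) and \<open>F\<close> is a cutoff which is
  concave except in a much thinner strip (\<open>exists_cutoff_profile\<close>). By concavity the terms that the trace
  condition cannot control have a favourable sign, and the remaining ones tend to zero, leaving
  \<open>\<integral>\<bar>w\<bar> \<le> 0\<close>. The smoothness of the boundary enters only in the construction of \<open>\<psi>\<close>.
\<close>

section \<open>Functions of class \<open>C\<^sup>k\<close>\<close>

lemma partial_deriv_eqI:
  assumes "(f has_derivative D) (at x)"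
  shows "partial_deriv k f x = D (axis k 1)"
  using frechet_derivative_at[OF assms] by (simp add: partial_deriv_def)

lemma Ck_on_cong_imp:
  assumes "open U" "\<And>x. x \<in> U \<Longrightarrow> f x = g x" "Ck_on m f U"
  shows "Ck_on m g U"
  using assms(2,3)
proof (induction m arbitrary: f g)
  case 0
  then show ?case using continuous_on_cong[of U U f g] by simp
next
  case (Suc m)
  have df: "f differentiable_on U" using Suc.prems by simp
  have dg: "g differentiable_on U"
    using df Suc.prems(1) differentiable_transform_within[of f _ U 1 g]
    unfolding differentiable_on_def by (metis zero_less_one)
  have "partial_deriv k f x = partial_deriv k g x" if "x \<in> U" for k x
  proof -
    have "f differentiable at x"
      using df assms(1) that by (simp add: differentiable_on_eq_differentiable_at)
    from frechet_derivative_transform_within_open[OF this assms(1) that Suc.prems(1)]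
    show ?thesis by (simp add: partial_deriv_def)
  qed
  then have "Ck_on m (partial_deriv k g) U" for k
    using Suc.IH[of "partial_deriv k f" "partial_deriv k g"] Suc.prems(2) by simp
  then show ?case using dg by simp
qed

text \<open>The functions \<open>f\<close> and \<open>g\<close> have the same derivatives at \<open>x\<close>, so the choice operator behind
  \<open>frechet_derivative\<close> returns the same value for both, whether or not a derivative
  exists.\<close>

lemma partial_deriv_cong:
  assumes "open U" "\<And>x. x \<in> U \<Longrightarrow> f x = g x" "x \<in> U"
  shows "partial_deriv k f x = partial_deriv k g x"
proof -
  have "(f has_derivative D) (at x) \<longleftrightarrow> (g has_derivative D) (at x)" for D
    using assms by (metis has_derivative_transform_within_open)
  then show ?thesis by (simp add: partial_deriv_def frechet_derivative_def)
qed

lemma laplacian_cong: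
  assumes "open U" "\<And>x. x \<in> U \<Longrightarrow> f x = g x" "x \<in> U"
  shows "laplacian f x = laplacian g x"
  unfolding laplacian_def
  by (intro sum.cong refl partial_deriv_cong[OF assms(1) _ assms(3)])
     (rule partial_deriv_cong[OF assms(1,2)])

lemma Ck_on_subset: "Ck_on m f U \<Longrightarrow> V \<subseteq> U \<Longrightarrow> Ck_on m f V"
proof (induction m arbitrary: f)
  case 0
  then show ?case using continuous_on_subset by auto
next
  case (Suc m)
  then show ?case using differentiable_on_subset by (metis Ck_on.simps(2))
qed

text \<open>This reduces the regularity of a function that is extended by zero to two separate checks, one near
  its support and one away from it.\<close>

lemma Ck_on_Un:
  assumes "open U" "open V" "Ck_on m f U" "Ck_on m f V"
  shows "Ck_on m f (U \<union> V)"
  using assms(3,4)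
proof (induction m arbitrary: f)
  case 0
  then show ?case using assms(1,2) continuous_on_open_Un by auto
next
  case (Suc m)
  then show ?case using assms(1,2)
    by (auto simp: differentiable_on_eq_differentiable_at open_Un)
qed

lemma Ck_on_SucD: "Ck_on (Suc m) f U \<Longrightarrow> Ck_on m f U"
proof (induction m arbitrary: f)
  case 0
  then show ?case by (simp add: differentiable_imp_continuous_on)
next
  case (Suc m)
  then show ?case by (metis Ck_on.simps(2))
qed

lemma Ck_on_imp_continuous_on: "Ck_on m f U \<Longrightarrow> continuous_on U f"
  by (cases m) (auto simp: differentiable_imp_continuous_on)

lemma partial_deriv_const [simp]: "partial_deriv k (\<lambda>x. c) = (\<lambda>x. 0)"
  by (rule ext) (simp add: partial_deriv_def)

lemma Ck_on_const: "Ck_on m (\<lambda>x. c) U"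
proof (induction m arbitrary: c)
  case (Suc m)
  then show ?case by simp
qed simp

lemma partial_deriv_add:
  assumes "f differentiable at x" "g differentiable at x"
  shows "partial_deriv k (\<lambda>x. f x + g x) x = partial_deriv k f x + partial_deriv k g x"
  using partial_deriv_eqI[OF has_derivative_add[OF assms[unfolded frechet_derivative_works]]]
  by (simp add: partial_deriv_def)

lemma Ck_on_add:
  assumes "open U" "Ck_on m f U" "Ck_on m g U"
  shows "Ck_on m (\<lambda>x. f x + g x) U"
  using assms(2,3)
proof (induction m arbitrary: f g)
  case 0
  then show ?case by (simp add: continuous_on_add)
next
  case (Suc m)
  have "Ck_on m (partial_deriv k (\<lambda>x. f x + g x)) U" for k
  proof (rule Ck_on_cong_imp[OF assms(1)])
    show "Ck_on m (\<lambda>x. partial_deriv k f x + partial_deriv k g x) U"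
      using Suc by simp
    fix x assume "x \<in> U"
    then show "partial_deriv k f x + partial_deriv k g x = partial_deriv k (\<lambda>x. f x + g x) x"
      using Suc.prems assms(1)
      by (simp add: differentiable_on_eq_differentiable_at partial_deriv_add)
  qed
  then show ?case using Suc.prems by (simp add: differentiable_on_add)
qed

lemma partial_deriv_mult:
  assumes "f differentiable at x" "g differentiable at x"
  shows "partial_deriv k (\<lambda>x. f x * g x) x = f x * partial_deriv k g x + g x * partial_deriv k f x"
  using partial_deriv_eqI[OF has_derivative_mult[OF assms[unfolded frechet_derivative_works]]]
  by (simp add: partial_deriv_def algebra_simps)

lemma Ck_on_mult:
  assumes "open U" "Ck_on m f U" "Ck_on m g U"
  shows "Ck_on m (\<lambda>x. f x * g x) U"
  using assms(2,3)
proof (induction m arbitrary: f g)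
  case 0
  then show ?case by (simp add: continuous_on_mult)
next
  case (Suc m)
  have "Ck_on m (partial_deriv k (\<lambda>x. f x * g x)) U" for k
  proof (rule Ck_on_cong_imp[OF assms(1)])
    show "Ck_on m (\<lambda>x. f x * partial_deriv k g x + g x * partial_deriv k f x) U"
      using Suc.prems Ck_on_SucD[OF Suc.prems(1)] Ck_on_SucD[OF Suc.prems(2)]
      by (intro Ck_on_add assms Suc.IH) auto
    fix x assume "x \<in> U"
    then show "f x * partial_deriv k g x + g x * partial_deriv k f x = partial_deriv k (\<lambda>x. f x * g x) x"
      using Suc.prems assms(1)
      by (simp add: differentiable_on_eq_differentiable_at partial_deriv_mult)
  qed
  then show ?case using Suc.prems by (simp add: differentiable_on_mult)
qed

lemma Ck_on_sum:
  assumes "open U" "\<And>i. i \<in> I \<Longrightarrow> Ck_on m (f i) U"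
  shows "Ck_on m (\<lambda>x. \<Sum>i\<in>I. f i x) U"
proof (cases "finite I")
  case True
  then show ?thesis using assms(2)
    by (induction I rule: finite_induct) (auto intro: Ck_on_const Ck_on_add[OF assms(1)])
qed (simp add: Ck_on_const)

lemma Ck_on_component: "Ck_on m (\<lambda>x::real^'n::finite. x $ k) U"
proof (cases m)
  case (Suc m')
  have D: "((\<lambda>x::real^'n. x $ k) has_derivative (\<lambda>x. x $ k)) (at x)" for x
    by (rule bounded_linear_imp_has_derivative) (rule bounded_linear_vec_nth)
  then have "partial_deriv l (\<lambda>x::real^'n. x $ k) = (\<lambda>x. axis l 1 $ k)" for l
    using partial_deriv_eqI[OF D] by auto
  moreover have "(\<lambda>x::real^'n. x $ k) differentiable_on U"
    using D differentiable_def by (metis differentiable_at_imp_differentiable_on)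
  ultimately show ?thesis using Suc by (simp add: Ck_on_const)
qed (simp add: continuous_on_component)

lemma differentiable_compose_real:
  assumes "f differentiable at x" "(F has_real_derivative F') (at (f x))"
  shows "(\<lambda>x. F (f x)) differentiable at x"
  using DERIV_compose_FDERIV[OF assms(2) assms(1)[unfolded frechet_derivative_works]]
  unfolding differentiable_def by blast

lemma partial_deriv_compose:
  assumes "f differentiable at x" "(F has_real_derivative F') (at (f x))"
  shows "partial_deriv k (\<lambda>x. F (f x)) x = F' * partial_deriv k f x"
  using partial_deriv_eqI[OF DERIV_compose_FDERIV[OF assms(2) assms(1)[unfolded frechet_derivative_works]]]
  by (simp add: partial_deriv_def)

text \<open>The outer function comes with a whole family \<open>D\<close> of successive derivatives because the chain rule
  replaces the family by its shift, so that induction on the order applies.\<close>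

lemma Ck_on_compose:
  assumes "open U" "Ck_on m f U"
    and "\<And>i t. i < m \<Longrightarrow> (D i has_real_derivative D (Suc i) t) (at t)"
    and "continuous_on UNIV (D m)"
  shows "Ck_on m (\<lambda>x. D 0 (f x)) U"
  using assms(2-)
proof (induction m arbitrary: D)
  case 0
  then show ?case
    by (metis Ck_on.simps(1) continuous_on_compose2 subset_UNIV)
next
  case (Suc m)
  have df: "f differentiable at x" if "x \<in> U" for x
    using Suc.prems assms(1) that by (simp add: differentiable_on_eq_differentiable_at)
  have D0: "(D 0 has_real_derivative D 1 t) (at t)" for t
    using Suc.prems(2)[of 0 t] by simp
  have C: "Ck_on m (partial_deriv k (\<lambda>x. D 0 (f x))) U" for k
  proof (rule Ck_on_cong_imp[OF assms(1)])
    have "Ck_on m (\<lambda>x. D 1 (f x)) U"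
      using Suc.IH[of "\<lambda>i. D (Suc i)"] Suc.prems(2,3) Ck_on_SucD[OF Suc.prems(1)] by simp
    then show "Ck_on m (\<lambda>x. D 1 (f x) * partial_deriv k f x) U"
      using Suc.prems(1) by (intro Ck_on_mult assms) simp_all
  qed (simp add: partial_deriv_compose[OF df D0])
  moreover have "(\<lambda>x. D 0 (f x)) differentiable_on U"
    using df D0[unfolded has_field_derivative_def]
    by (intro differentiable_at_imp_differentiable_on differentiable_chain_at[of f _ "D 0", unfolded o_def])
       (auto simp: differentiable_def)
  ultimately show ?case by simp
qed

lemma C2_differentiable:
  assumes "Ck_on 2 f U" "open U" "x \<in> U"
  shows "f differentiable at x" "partial_deriv k f differentiable at x"
  using assms by (auto simp: differentiable_on_eq_differentiable_at numeral_2_eq_2)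

lemma C2_continuous:
  assumes "Ck_on 2 f U"
  shows "continuous_on U f" "continuous_on U (partial_deriv k f)"
    "continuous_on U (partial_deriv l (partial_deriv k f))" "continuous_on U (laplacian f)"
proof -
  have 2: "Ck_on (Suc (Suc 0)) f U" using assms by (simp add: numeral_2_eq_2)
  then show "continuous_on U f" "continuous_on U (partial_deriv k f)"
    by (auto simp: differentiable_imp_continuous_on)
  have c: "continuous_on U (partial_deriv l (partial_deriv k f))" for l k
    using 2 by auto
  then show "continuous_on U (partial_deriv l (partial_deriv k f))" .
  show "continuous_on U (laplacian f)"
    unfolding laplacian_def by (intro continuous_on_sum c)
qed

lemma Ck_on_2_compose:
  assumes "open U" "Ck_on 2 f U"
    and "\<And>t. (F has_real_derivative F' t) (at t)" "\<And>t. (F' has_real_derivative F'' t) (at t)"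
    and "continuous_on UNIV F''"
  shows "Ck_on 2 (\<lambda>x. F (f x)) U"
proof -
  define D where "D = (\<lambda>i::nat. if i = 0 then F else if i = 1 then F' else F'')"
  have "Ck_on 2 (\<lambda>x. D 0 (f x)) U"
    by (rule Ck_on_compose[OF assms(1,2)]) (use assms(3-) in \<open>auto simp: D_def less_2_cases_iff\<close>)
  then show ?thesis by (simp add: D_def)
qed

lemma laplacian_mult:
  assumes "open U" "Ck_on 2 f U" "Ck_on 2 g U" "x \<in> U"
  shows "laplacian (\<lambda>x. f x * g x) x =
    f x * laplacian g x + 2 * (\<Sum>k\<in>UNIV. partial_deriv k f x * partial_deriv k g x) + g x * laplacian f x"
proof -
  note df = C2_differentiable[OF assms(2,1)] and dg = C2_differentiable[OF assms(3,1)]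
  have "partial_deriv k (partial_deriv k (\<lambda>x. f x * g x)) x =
     f x * partial_deriv k (partial_deriv k g) x + 2 * (partial_deriv k f x * partial_deriv k g x)
     + g x * partial_deriv k (partial_deriv k f) x" for k
  proof -
    have "partial_deriv k (partial_deriv k (\<lambda>x. f x * g x)) x =
      partial_deriv k (\<lambda>x. f x * partial_deriv k g x + g x * partial_deriv k f x) x"
      by (rule partial_deriv_cong[OF assms(1) _ assms(4)]) (simp add: partial_deriv_mult df dg)
    also have "\<dots> = partial_deriv k (\<lambda>x. f x * partial_deriv k g x) x + partial_deriv k (\<lambda>x. g x * partial_deriv k f x) x"
      by (rule partial_deriv_add) (simp_all add: differentiable_mult df dg assms(4))
    finally show ?thesis using assms(4) by (simp add: partial_deriv_mult df dg algebra_simps)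
  qed
  then show ?thesis by (simp add: laplacian_def sum.distrib sum_distrib_left)
qed

lemma laplacian_compose:
  assumes "open U" "Ck_on 2 f U" "x \<in> U"
    and F: "\<And>t. (F has_real_derivative F' t) (at t)" "\<And>t. (F' has_real_derivative F'' t) (at t)"
  shows "laplacian (\<lambda>x. F (f x)) x =
    F' (f x) * laplacian f x + F'' (f x) * (\<Sum>k\<in>UNIV. (partial_deriv k f x)\<^sup>2)"
proof -
  note df = C2_differentiable[OF assms(2,1)]
  have dF': "(\<lambda>x. F' (f x)) differentiable at x" 
    by (rule differentiable_compose_real[OF df(1)[OF assms(3)] F(2)])
  have "partial_deriv k (partial_deriv k (\<lambda>x. F (f x))) x =
     F' (f x) * partial_deriv k (partial_deriv k f) x + F'' (f x) * (partial_deriv k f x)\<^sup>2" for k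
  proof -
    have "partial_deriv k (partial_deriv k (\<lambda>x. F (f x))) x =
      partial_deriv k (\<lambda>x. F' (f x) * partial_deriv k f x) x"
      by (rule partial_deriv_cong[OF assms(1) _ assms(3)]) (simp add: partial_deriv_compose[OF df(1) F(1)])
    then show ?thesis
      using partial_deriv_mult[OF dF' df(2)[OF assms(3)]] partial_deriv_compose[OF df(1)[OF assms(3)] F(2)]
      by (simp add: power2_eq_square algebra_simps)
  qed
  then show ?thesis by (simp add: laplacian_def sum.distrib sum_distrib_left)
qed

lemma has_derivative_translate_iff:
  "((\<lambda>y. f (y - a)) has_derivative D) (at y) \<longleftrightarrow> (f has_derivative D) (at (y - a))"
    (is "?L \<longleftrightarrow> ?R")
proof
  assume ?R
  have "((\<lambda>y. y - a) has_derivative (\<lambda>h. h)) (at y)"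
    by (auto intro!: derivative_eq_intros)
  from has_derivative_compose[OF this \<open>?R\<close>] show ?L .
next
  assume ?L
  then have *: "((\<lambda>y. f (y - a)) has_derivative D) (at ((y - a) + a))" by simp
  have "((\<lambda>y. y + a) has_derivative (\<lambda>h. h)) (at (y - a))"
    by (auto intro!: derivative_eq_intros)
  from has_derivative_compose[OF this *] show ?R by simp
qed

lemma partial_deriv_translate:
  "partial_deriv k (\<lambda>y. f (y - a)) = (\<lambda>y. partial_deriv k f (y - a))"
  by (rule ext) (simp add: partial_deriv_def frechet_derivative_def has_derivative_translate_iff)

lemma laplacian_translate: "laplacian (\<lambda>y. f (y - a)) y = laplacian f (y - a)"
  by (simp add: laplacian_def partial_deriv_translate)

lemma Ck_on_translate: "Ck_on m f UNIV \<Longrightarrow> Ck_on m (\<lambda>y. f (y - a)) UNIV"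
proof (induction m arbitrary: f)
  case 0
  then have "continuous_on UNIV f" by simp
  moreover have "continuous_on UNIV (\<lambda>y. y - a)" by (intro continuous_intros)
  ultimately show ?case by (simp add: continuous_on_compose2[of UNIV f])
next
  case (Suc m)
  have "(\<lambda>y. f (y - a)) differentiable_on UNIV"
    using Suc.prems
    by (simp add: differentiable_on_eq_differentiable_at differentiable_def has_derivative_translate_iff)
  then show ?case using Suc by (simp add: partial_deriv_translate)
qed

section \<open>Continuity of translations in \<open>L\<^sup>1\<close>\<close>

lemma integrable_translate:
  fixes f :: "'a::euclidean_space \<Rightarrow> real"
  assumes "integrable lborel f"
  shows "integrable lborel (\<lambda>x. f (x + z))"
proof -
  have "integrable (distr lborel borel ((+) z)) f" using assms by (simp add: lborel_distr_plus)
  then show ?thesis using assms by (subst (asm) integrable_distr_eq) (auto simp: add.commute)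
qed

lemma integral_translate:
  fixes f :: "'a::euclidean_space \<Rightarrow> real"
  assumes "f \<in> borel_measurable borel"
  shows "(\<integral>x. f (x + z) \<partial>lborel) = (\<integral>x. f x \<partial>lborel)"
proof -
  have "(\<integral>x. f x \<partial>lborel) = (\<integral>x. f x \<partial>(distr lborel borel ((+) z)))" by (simp add: lborel_distr_plus)
  also have "\<dots> = (\<integral>x. f (z + x) \<partial>lborel)" using assms by (subst integral_distr) auto
  finally show ?thesis by (simp add: add.commute)
qed

text \<open>Translations are isometries of \<open>L\<^sup>1\<close>, so the modulus of continuity of \<open>f\<close> exceeds that of \<open>g\<close> by at
  most twice the distance of \<open>f\<close> and \<open>g\<close>. Hence the functions with a modulus tending to zero are closed
  in \<open>L\<^sup>1\<close>.\<close>

lemma translation_continuous_approx: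
  fixes f :: "'a::euclidean_space \<Rightarrow> real"
  assumes f: "integrable lborel f"
    and approx: "\<And>e. e > 0 \<Longrightarrow> \<exists>g. integrable lborel g \<and> (\<integral>x. \<bar>f x - g x\<bar> \<partial>lborel) < e \<and>
        ((\<lambda>z. \<integral>x. \<bar>g (x + z) - g x\<bar> \<partial>lborel) \<longlongrightarrow> 0) (at 0)"
  shows "((\<lambda>z. \<integral>x. \<bar>f (x + z) - f x\<bar> \<partial>lborel) \<longlongrightarrow> 0) (at 0)"
proof (rule tendstoI)
  fix e :: real assume "e > 0"
  then obtain g where g: "integrable lborel g" "(\<integral>x. \<bar>f x - g x\<bar> \<partial>lborel) < e / 3"
      and lim: "((\<lambda>z. \<integral>x. \<bar>g (x + z) - g x\<bar> \<partial>lborel) \<longlongrightarrow> 0) (at 0)"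
    using approx[of "e / 3"] by auto
  have "\<forall>\<^sub>F z in at 0. dist (\<integral>x. \<bar>g (x + z) - g x\<bar> \<partial>lborel) 0 < e / 3"
    using lim \<open>e > 0\<close> by (intro tendstoD) auto
  then show "\<forall>\<^sub>F z in at 0. dist (\<integral>x. \<bar>f (x + z) - f x\<bar> \<partial>lborel) 0 < e"
  proof eventually_elim
    case (elim z)
    note int = f g(1) integrable_translate[OF f, of z] integrable_translate[OF g(1), of z]
    have "(\<integral>x. \<bar>f (x + z) - f x\<bar> \<partial>lborel)
      \<le> (\<integral>x. \<bar>f (x + z) - g (x + z)\<bar> + \<bar>g (x + z) - g x\<bar> + \<bar>f x - g x\<bar> \<partial>lborel)"
      by (intro integral_mono integrable_abs Bochner_Integration.integrable_add
            Bochner_Integration.integrable_diff int) linarith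
    also have "\<dots> = (\<integral>x. \<bar>f (x + z) - g (x + z)\<bar> \<partial>lborel) + (\<integral>x. \<bar>g (x + z) - g x\<bar> \<partial>lborel)
        + (\<integral>x. \<bar>f x - g x\<bar> \<partial>lborel)"
      using int by simp
    also have "(\<integral>x. \<bar>f (x + z) - g (x + z)\<bar> \<partial>lborel) = (\<integral>x. \<bar>f x - g x\<bar> \<partial>lborel)"
      using f g(1) by (intro integral_translate[where f = "\<lambda>x. \<bar>f x - g x\<bar>"]) auto
    finally have "(\<integral>x. \<bar>f (x + z) - f x\<bar> \<partial>lborel) < e"
      using elim g(2) by (simp add: dist_real_def)
    then show ?case by (simp add: dist_real_def)
  qed
qed

text \<open>For indicator values, \<open>\<bar>a - b\<bar> = a + b - 2 * a * b\<close>. The first two terms have a constant integral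
  under translation, and in the product the translated factor tends to 1 at every point of the open
  set, so dominated convergence applies.\<close>

lemma translation_continuous_open:
  fixes U :: "'a::euclidean_space set"
  assumes U: "open U" "emeasure lborel U < \<infinity>"
  shows "((\<lambda>z. \<integral>x. \<bar>indicator U (x + z) - indicator U x :: real\<bar> \<partial>lborel) \<longlongrightarrow> 0) (at 0)"
  unfolding tendsto_at_iff_sequentially
proof (intro allI impI)
  fix X :: "nat \<Rightarrow> 'a"
  assume X: "X \<longlonglongrightarrow> 0"
  have [measurable]: "U \<in> sets borel" using U by simp
  have iU: "integrable lborel (indicator U :: 'a \<Rightarrow> real)" using U by (simp add: integrable_indicator_iff)
  note iUz = integrable_translate[OF iU]
  have iUU: "integrable lborel (\<lambda>x. indicator U x * indicator U (x + z) :: real)" for z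
    by (rule Bochner_Integration.integrable_bound[OF iU]) (auto simp: indicator_def)
  have "(\<lambda>n. \<integral>x. indicator U x * indicator U (x + X n) \<partial>lborel) \<longlonglongrightarrow> (\<integral>x. indicator U x \<partial>lborel :: real)"
  proof (rule integral_dominated_convergence[where w = "indicator U"])
    show "AE x in lborel. (\<lambda>n. indicator U x * indicator U (x + X n)) \<longlonglongrightarrow> (indicator U x :: real)"
    proof (rule AE_I2)
      fix x :: 'a
      show "(\<lambda>n. indicator U x * indicator U (x + X n)) \<longlonglongrightarrow> (indicator U x :: real)"
      proof (cases "x \<in> U")
        case True
        have "(\<lambda>n. x + X n) \<longlonglongrightarrow> x" using tendsto_add[OF tendsto_const X, of x] by simp
        then have "\<forall>\<^sub>F n in sequentially. x + X n \<in> U"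
          using U(1) True by (rule topological_tendstoD)
        then show ?thesis
          by (intro tendsto_eventually) (auto elim!: eventually_mono simp: True)
      qed simp
    qed
  qed (use iU in \<open>auto simp: indicator_def\<close>)
  from tendsto_diff[OF tendsto_const[of "2 * (\<integral>x. indicator U x \<partial>lborel :: real)"] tendsto_mult[OF tendsto_const[of 2] this]]
  have "(\<lambda>n. 2 * (\<integral>x. indicator U x \<partial>lborel) - 2 * (\<integral>x. indicator U x * indicator U (x + X n) \<partial>lborel)) \<longlonglongrightarrow> (0::real)"
    by simp
  moreover have "(\<integral>x. \<bar>indicator U (x + z) - indicator U x\<bar> \<partial>lborel)
     = 2 * (\<integral>x. indicator U x \<partial>lborel) - 2 * (\<integral>x. indicator U x * indicator U (x + z) \<partial>lborel :: real)" for z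
  proof -
    have "(\<integral>x. \<bar>indicator U (x + z) - indicator U x\<bar> \<partial>lborel)
      = (\<integral>x. (indicator U (x + z) + indicator U x) - 2 * (indicator U x * indicator U (x + z)) \<partial>lborel :: real)"
      by (intro Bochner_Integration.integral_cong) (auto simp: indicator_def)
    also have "\<dots> = (\<integral>x. indicator U (x + z) \<partial>lborel) + (\<integral>x. indicator U x \<partial>lborel)
        - 2 * (\<integral>x. indicator U x * indicator U (x + z) \<partial>lborel)"
      using iU iUz iUU by (simp del: integral_indicator)
    also have "(\<integral>x. indicator U (x + z) \<partial>lborel) = (\<integral>x. indicator U x \<partial>lborel :: real)"
      by (rule integral_translate) simp
    finally show ?thesis by simp
  qed
  ultimately show "((\<lambda>z. \<integral>x. \<bar>indicator U (x + z) - indicator U x :: real\<bar> \<partial>lborel) \<circ> X) \<longlonglongrightarrow> 0"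
    by (simp add: o_def)
qed

text \<open>A Borel set of finite measure is, up to small measure, an open set, and simple functions are dense
  in \<open>L\<^sup>1\<close>.\<close>

lemma translation_continuous_L1:
  fixes f :: "'a::euclidean_space \<Rightarrow> real"
  assumes "integrable lborel f"
  shows "((\<lambda>z. \<integral>x. \<bar>f (x + z) - f x\<bar> \<partial>lborel) \<longlongrightarrow> 0) (at 0)"
  using assms
proof (induction rule: integrable_induct)
  case (base A c)
  have A[measurable]: "A \<in> sets borel" using base by simp
  have iA: "integrable lborel (\<lambda>x. indicator A x :: real)"
    using base by (simp add: integrable_indicator_iff)
  have "((\<lambda>z. \<integral>x. \<bar>indicator A (x + z) - indicator A x :: real\<bar> \<partial>lborel) \<longlongrightarrow> 0) (at 0)"
  proof (rule translation_continuous_approx[OF iA])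
    fix e :: real assume "e > 0"
    obtain U where U: "open U" "A \<subseteq> U" "U - A \<in> lmeasurable" "emeasure lebesgue (U - A) < ennreal e"
      using sets_lebesgue_outer_open[of A e] \<open>e > 0\<close> A by auto
    have [measurable]: "U \<in> sets borel" using U by simp
    have m: "emeasure lborel (U - A) < ennreal e" using U by simp
    have "emeasure lborel U = emeasure lborel A + emeasure lborel (U - A)"
      using U(2) by (subst plus_emeasure) (auto simp: Un_absorb1)
    also have "\<dots> < \<infinity>" using base(2) m by (auto simp: less_top[symmetric])
    finally have fU: "emeasure lborel U < \<infinity>" .
    have "(\<integral>x. \<bar>indicator A x - indicator U x\<bar> \<partial>lborel) = (\<integral>x. indicator (U - A) x \<partial>lborel :: real)"
      using U(2) by (intro Bochner_Integration.integral_cong) (auto simp: indicator_def)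
    also have "\<dots> = measure lborel (U - A)" by simp
    also have "\<dots> < e" using m \<open>e > 0\<close>
      by (metis emeasure_eq_ennreal_measure ennreal_less_iff measure_nonneg order.strict_trans2 top_greatest less_top ennreal_less_top)
    finally show "\<exists>g. integrable lborel g \<and> (\<integral>x. \<bar>indicator A x - g x\<bar> \<partial>lborel) < e \<and>
        ((\<lambda>z. \<integral>x. \<bar>g (x + z) - g x\<bar> \<partial>lborel) \<longlongrightarrow> 0) (at 0)"
      using translation_continuous_open[OF U(1) fU] fU
      by (intro exI[of _ "indicator U"]) (auto simp: integrable_indicator_iff)
  qed
  from tendsto_mult[OF tendsto_const[of "\<bar>c\<bar>"] this]
  have "((\<lambda>z. \<bar>c\<bar> * (\<integral>x. \<bar>indicator A (x + z) - indicator A x :: real\<bar> \<partial>lborel)) \<longlongrightarrow> 0) (at 0)" by simp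
  moreover have "\<bar>c\<bar> * (\<integral>x. \<bar>indicator A (x + z) - indicator A x :: real\<bar> \<partial>lborel)
    = (\<integral>x. \<bar>indicator A (x + z) *\<^sub>R c - indicator A x *\<^sub>R c\<bar> \<partial>lborel)" for z
    by (subst integral_mult_right_zero[symmetric], intro Bochner_Integration.integral_cong)
       (auto simp: abs_mult[symmetric] algebra_simps)
  ultimately show ?case by simp
next
  case (add f g)
  have "((\<lambda>z. (\<integral>x. \<bar>f (x + z) - f x\<bar> \<partial>lborel) + (\<integral>x. \<bar>g (x + z) - g x\<bar> \<partial>lborel)) \<longlongrightarrow> 0) (at 0)"
    using tendsto_add[OF add.IH] by simp
  moreover have "(\<integral>x. \<bar>(f (x + z) + g (x + z)) - (f x + g x)\<bar> \<partial>lborel)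
      \<le> (\<integral>x. \<bar>f (x + z) - f x\<bar> \<partial>lborel) + (\<integral>x. \<bar>g (x + z) - g x\<bar> \<partial>lborel)" for z
  proof -
    note int = add.hyps integrable_translate[OF add.hyps(1), of z] integrable_translate[OF add.hyps(2), of z]
    have "(\<integral>x. \<bar>(f (x + z) + g (x + z)) - (f x + g x)\<bar> \<partial>lborel)
      \<le> (\<integral>x. \<bar>f (x + z) - f x\<bar> + \<bar>g (x + z) - g x\<bar> \<partial>lborel)"
      by (intro integral_mono integrable_abs Bochner_Integration.integrable_add
            Bochner_Integration.integrable_diff int) linarith
    then show ?thesis using int by simp
  qed
  ultimately show ?case
    by (intro Lim_null_comparison[where f = "\<lambda>z. \<integral>x. \<bar>(f (x + z) + g (x + z)) - (f x + g x)\<bar> \<partial>lborel"])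
       (auto intro: always_eventually)
next
  case (lim f s)
  show ?case
  proof (rule translation_continuous_approx[OF lim.hyps(4)])
    fix e :: real assume "e > 0"
    have "(\<lambda>i. \<integral>x. \<bar>f x - s i x\<bar> \<partial>lborel) \<longlonglongrightarrow> (\<integral>x. 0 \<partial>(lborel :: 'a measure))"
    proof (rule integral_dominated_convergence[where w = "\<lambda>x. 3 * \<bar>f x\<bar>"])
      show "AE x in lborel. (\<lambda>i. \<bar>f x - s i x\<bar>) \<longlonglongrightarrow> 0"
      proof (rule AE_I2)
        fix x :: 'a
        have "(\<lambda>i. s i x) \<longlonglongrightarrow> f x" using lim.hyps(2)[of x] by simp
        from tendsto_rabs[OF tendsto_diff[OF tendsto_const this, of "f x"]]
        show "(\<lambda>i. \<bar>f x - s i x\<bar>) \<longlonglongrightarrow> 0" by simp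
      qed
      show "AE x in lborel. norm \<bar>f x - s i x\<bar> \<le> 3 * \<bar>f x\<bar>" for i
      proof (rule AE_I2)
        fix x show "norm \<bar>f x - s i x\<bar> \<le> 3 * \<bar>f x\<bar>" using lim.hyps(3)[of x i] by auto
      qed
    qed (use lim.hyps(1,4) in auto)
    then have "\<forall>\<^sub>F i in sequentially. (\<integral>x. \<bar>f x - s i x\<bar> \<partial>lborel) < e"
      using \<open>e > 0\<close> by (intro order_tendstoD) auto
    then obtain i where "(\<integral>x. \<bar>f x - s i x\<bar> \<partial>lborel) < e"
      by (auto simp: eventually_sequentially)
    then show "\<exists>g. integrable lborel g \<and> (\<integral>x. \<bar>f x - g x\<bar> \<partial>lborel) < e \<and>
        ((\<lambda>z. \<integral>x. \<bar>g (x + z) - g x\<bar> \<partial>lborel) \<longlongrightarrow> 0) (at 0)"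
      using lim.hyps(1) lim.IH by blast
  qed
qed

section \<open>Functions with bounded support and second differences\<close>

lemma integrable_bounded_mult:
  fixes f g :: "'a \<Rightarrow> real"
  assumes "integrable M f" "g \<in> borel_measurable M" "\<And>x. \<bar>g x\<bar> \<le> C"
  shows "integrable M (\<lambda>x. f x * g x)"
proof (rule Bochner_Integration.integrable_bound)
  show "integrable M (\<lambda>x. C * f x)" using assms(1) by simp
  have "\<bar>f x\<bar> * \<bar>g x\<bar> \<le> \<bar>C\<bar> * \<bar>f x\<bar>" for x
    using assms(3)[of x] mult_right_mono[of "\<bar>g x\<bar>" "\<bar>C\<bar>" "\<bar>f x\<bar>"] by (simp add: mult.commute)
  then show "AE x in M. norm (f x * g x) \<le> norm (C * f x)" by (simp add: abs_mult)
qed (use assms in measurable)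

lemma bounded_of_bounded_support:
  fixes g :: "'a::euclidean_space \<Rightarrow> real"
  assumes "continuous_on UNIV g" "bounded {x. g x \<noteq> 0}"
  obtains C where "C > 0" "\<And>x. \<bar>g x\<bar> \<le> C"
proof -
  have "compact (g ` closure {x. g x \<noteq> 0})"
    using assms by (intro compact_continuous_image) (auto intro: continuous_on_subset simp: compact_closure)
  then obtain C where "C > 0" and C: "\<And>y. y \<in> g ` closure {x. g x \<noteq> 0} \<Longrightarrow> norm y \<le> C"
    using compact_imp_bounded bounded_pos by metis
  have "\<bar>g x\<bar> \<le> C" for x
    using C[of "g x"] \<open>C > 0\<close> closure_subset[of "{x. g x \<noteq> 0}"] by (cases "g x = 0") auto
  with \<open>C > 0\<close> show ?thesis using that by blast
qed

lemma integrable_continuous_bounded_support: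
  fixes g :: "'a::euclidean_space \<Rightarrow> real"
  assumes "continuous_on UNIV g" "bounded {x. g x \<noteq> 0}"
  shows "integrable lborel g"
proof -
  define S where "S = closure {x. g x \<noteq> 0}"
  have S: "compact S" using assms by (simp add: S_def compact_closure)
  have "integrable lborel (\<lambda>x. indicator S x *\<^sub>R g x)"
    by (rule borel_integrable_compact[OF S continuous_on_subset[OF assms(1)]]) auto
  moreover have "(\<lambda>x. indicator S x *\<^sub>R g x) = g"
    using closure_subset[of "{x. g x \<noteq> 0}"] by (auto simp: S_def indicator_def fun_eq_iff)
  ultimately show ?thesis by simp
qed

lemma uniformly_continuous_bounded_support:
  fixes g :: "'a::euclidean_space \<Rightarrow> real"
  assumes "continuous_on UNIV g" "bounded {x. g x \<noteq> 0}" "e > 0"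
  obtains d where "d > 0" "\<And>x y. dist x y < d \<Longrightarrow> \<bar>g x - g y\<bar> < e"
proof -
  obtain R where R: "\<And>x. g x \<noteq> 0 \<Longrightarrow> norm x \<le> R"
    using assms(2) bounded_pos[of "{x. g x \<noteq> 0}"] by auto
  have "uniformly_continuous_on (cball 0 (R + 1)) g"
    by (rule compact_uniformly_continuous) (use assms(1) continuous_on_subset in auto)
  then obtain d where "d > 0" and d: "\<And>x y. x \<in> cball 0 (R + 1) \<Longrightarrow> y \<in> cball 0 (R + 1) \<Longrightarrow> dist y x < d \<Longrightarrow> dist (g y) (g x) < e"
    using \<open>e > 0\<close> unfolding uniformly_continuous_on_def by meson
  have "\<bar>g x - g y\<bar> < e" if "dist x y < min d 1" for x y
  proof (cases "x \<in> cball 0 (R + 1) \<and> y \<in> cball 0 (R + 1)")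
    case True
    then show ?thesis using d[of y x] that by (simp add: dist_real_def)
  next
    case False
    have "\<bar>norm x - norm y\<bar> < 1" using that norm_triangle_ineq3[of x y] by (simp add: dist_norm)
    then have "norm x > R" "norm y > R" using False by auto
    then have "g x = 0" "g y = 0" using R by (meson not_le)+
    then show ?thesis using \<open>e > 0\<close> by simp
  qed
  then show ?thesis using \<open>d > 0\<close> that[of "min d 1"] by simp
qed

lemma partial_deriv_outside_support:
  assumes "x \<notin> closure {x. f x \<noteq> 0}"
  shows "partial_deriv k f x = 0"
proof -
  have "partial_deriv k f x = partial_deriv k (\<lambda>x. 0) x"
    by (rule partial_deriv_cong[of "- closure {x. f x \<noteq> 0}"])
       (use assms closure_subset[of "{x. f x \<noteq> 0}"] in auto)
  then show ?thesis by simp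
qed

lemma laplacian_outside_support:
  assumes "x \<notin> closure {x. f x \<noteq> 0}"
  shows "laplacian f x = 0" "partial_deriv l (partial_deriv k f) x = 0"
proof -
  have 2: "partial_deriv l (partial_deriv k f) x = 0" for l k
  proof -
    have "partial_deriv l (partial_deriv k f) x = partial_deriv l (\<lambda>x. 0) x"
      by (rule partial_deriv_cong[of "- closure {x. f x \<noteq> 0}"])
         (use assms partial_deriv_outside_support in auto)
    then show ?thesis by simp
  qed
  then show "partial_deriv l (partial_deriv k f) x = 0" .
  show "laplacian f x = 0" by (simp add: laplacian_def 2)
qed

lemma bounded_support_derivatives:
  assumes "bounded {x. f x \<noteq> 0}"
  shows "bounded {x. partial_deriv k f x \<noteq> 0}" "bounded {x. partial_deriv l (partial_deriv k f) x \<noteq> 0}"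
    "bounded {x. laplacian f x \<noteq> 0}"
proof -
  have "bounded (closure {x. f x \<noteq> 0})" using assms by (rule bounded_closure)
  moreover have "{x. partial_deriv k f x \<noteq> 0} \<subseteq> closure {x. f x \<noteq> 0}"
    "{x. partial_deriv l (partial_deriv k f) x \<noteq> 0} \<subseteq> closure {x. f x \<noteq> 0}"
    "{x. laplacian f x \<noteq> 0} \<subseteq> closure {x. f x \<noteq> 0}"
    using partial_deriv_outside_support[of _ f] laplacian_outside_support[of _ f] by blast+
  ultimately show "bounded {x. partial_deriv k f x \<noteq> 0}"
    "bounded {x. partial_deriv l (partial_deriv k f) x \<noteq> 0}" "bounded {x. laplacian f x \<noteq> 0}"
    using bounded_subset by blast+
qed

text \<open>The discrete Laplacian with step \<open>h\<close>.\<close>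

definition second_diff :: "real \<Rightarrow> (real^'n::finite \<Rightarrow> real) \<Rightarrow> real^'n \<Rightarrow> real" where
  "second_diff h f x = (\<Sum>k\<in>UNIV. (f (x + h *\<^sub>R axis k 1) + f (x - h *\<^sub>R axis k 1) - 2 * f x) / h\<^sup>2)"

lemma DERIV_along_axis:
  assumes "f differentiable at (x + t *\<^sub>R axis k 1)"
  shows "((\<lambda>t. f (x + t *\<^sub>R axis k 1)) has_real_derivative partial_deriv k f (x + t *\<^sub>R axis k 1)) (at t)"
proof -
  define D where "D = frechet_derivative f (at (x + t *\<^sub>R axis k 1))"
  have D: "(f has_derivative D) (at (x + t *\<^sub>R axis k 1))"
    using assms by (simp add: D_def frechet_derivative_works)
  then have lin: "linear D" by (rule has_derivative_linear)
  have "((\<lambda>t. x + t *\<^sub>R axis k 1) has_derivative (\<lambda>s. s *\<^sub>R axis k (1::real))) (at t)"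
    by (auto intro!: derivative_eq_intros)
  from has_derivative_compose[OF this D]
  have "((\<lambda>t. f (x + t *\<^sub>R axis k 1)) has_derivative (\<lambda>s. D (s *\<^sub>R axis k 1))) (at t)" .
  moreover have "(\<lambda>s. D (s *\<^sub>R axis k 1)) = (\<lambda>s. D (axis k 1) * s)"
    by (simp add: linear_scale[OF lin] mult.commute)
  ultimately show ?thesis by (simp add: has_field_derivative_def partial_deriv_def D_def)
qed

text \<open>The even part \<open>t \<mapsto> f (x + t e) + f (x - t e)\<close> of the restriction to a coordinate line has derivative zero at
  \<open>t = 0\<close>, so its Taylor formula of order two has no linear term.\<close>

lemma second_diff_axis_mean_value:
  assumes f: "Ck_on 2 f UNIV" and "h > 0"
  obtains t where "0 < t" "t < h"
    "(f (x + h *\<^sub>R axis k 1) + f (x - h *\<^sub>R axis k 1) - 2 * f x) / h\<^sup>2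
      = (partial_deriv k (partial_deriv k f) (x + t *\<^sub>R axis k 1)
        + partial_deriv k (partial_deriv k f) (x - t *\<^sub>R axis k 1)) / 2"
proof -
  define s where "s i t = (if i = 0 then f (x + t *\<^sub>R axis k 1) else if i = 1 then partial_deriv k f (x + t *\<^sub>R axis k 1)
     else partial_deriv k (partial_deriv k f) (x + t *\<^sub>R axis k 1))" for i :: nat and t
  \<comment> \<open>The derivatives of the even part \<open>s 0 t + s 0 (- t)\<close>.\<close>
  define g where "g i t = s i t + (-1) ^ i * s i (- t)" for i t
  have s_simps: "s 0 = (\<lambda>t. f (x + t *\<^sub>R axis k 1))" "s (Suc 0) = (\<lambda>t. partial_deriv k f (x + t *\<^sub>R axis k 1))"
    "s (Suc (Suc 0)) = (\<lambda>t. partial_deriv k (partial_deriv k f) (x + t *\<^sub>R axis k 1))"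
    by (simp_all add: s_def fun_eq_iff)
  have s: "(s i has_real_derivative s (Suc i) t) (at t)" if "i < 2" for i t
    using that C2_differentiable[OF f open_UNIV] DERIV_along_axis[of f x t k]
      DERIV_along_axis[of "partial_deriv k f" x t k]
    by (auto simp: s_simps less_2_cases_iff)
  have g: "(g i has_real_derivative g (Suc i) t) (at t)" if "i < 2" for i t
  proof -
    have "((\<lambda>t. s i (- t)) has_real_derivative s (Suc i) (- t) * (- 1)) (at t)"
      by (rule DERIV_chain2[OF s[OF that]]) (auto intro!: derivative_eq_intros)
    from DERIV_add[OF s[OF that] DERIV_cmult[OF this, of "(-1) ^ i"]]
    show ?thesis by (simp add: g_def[abs_def])
  qed
  obtain t where t: "0 < t" "t < h" and
    "g 0 h = (\<Sum>m<2. (g m 0 / fact m) * h ^ m) + (g 2 t / fact 2) * h ^ 2"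
    using Maclaurin[of h 2 g "g 0"] g \<open>h > 0\<close> by auto
  then have "g 0 h = 2 * s 0 0 + g 2 t / 2 * h\<^sup>2"
    by (simp add: numeral_2_eq_2 g_def)
  then show ?thesis using that[OF t] \<open>h > 0\<close>
    by (simp add: g_def s_def divide_simps) 
qed

text \<open>The mean value form compares the difference quotient with second derivatives at distance less than
  \<open>h\<close>, and these are uniformly continuous because the support is bounded.\<close>

lemma second_diff_uniform:
  assumes f: "Ck_on 2 f UNIV" "bounded {x. f x \<noteq> 0}" and "e > 0"
  obtains d where "d > 0" "\<And>h x. 0 < h \<Longrightarrow> h < d \<Longrightarrow> \<bar>second_diff h f x - laplacian f x\<bar> \<le> e"
proof -
  define N where "N = real CARD('a)"
  have N: "N > 0" by (simp add: N_def)
  have "\<exists>d>0. \<forall>x y. dist x y < d \<longrightarrow>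
      \<bar>partial_deriv k (partial_deriv k f) x - partial_deriv k (partial_deriv k f) y\<bar> < e / N" for k
    using uniformly_continuous_bounded_support[OF C2_continuous(3)[OF f(1), where l=k and k=k] bounded_support_derivatives(2)[OF f(2)], of "e / N"]
    \<open>e > 0\<close> N by (metis divide_pos_pos)
  then obtain d where d: "\<And>k. d k > 0" and
    close: "\<And>k x y. dist x y < d k \<Longrightarrow>
      \<bar>partial_deriv k (partial_deriv k f) x - partial_deriv k (partial_deriv k f) y\<bar> < e / N"
    by metis
  define D where "D = Min (range d)"
  have D: "D > 0" "\<And>k. D \<le> d k" using d by (auto simp: D_def)
  have mean_close: "\<bar>(a + b) / 2 - c\<bar> \<le> E" if "\<bar>a - c\<bar> < E" "\<bar>b - c\<bar> < E" for a b c E :: real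
    using that unfolding abs_less_iff abs_le_iff by (auto simp: field_simps)
  have "\<bar>second_diff h f x - laplacian f x\<bar> \<le> e" if h: "0 < h" "h < D" for h x
  proof -
    have "\<bar>(f (x + h *\<^sub>R axis k 1) + f (x - h *\<^sub>R axis k 1) - 2 * f x) / h\<^sup>2
       - partial_deriv k (partial_deriv k f) x\<bar> \<le> e / N" for k
    proof -
      obtain t where t: "0 < t" "t < h" and eq:
        "(f (x + h *\<^sub>R axis k 1) + f (x - h *\<^sub>R axis k 1) - 2 * f x) / h\<^sup>2
          = (partial_deriv k (partial_deriv k f) (x + t *\<^sub>R axis k 1)
            + partial_deriv k (partial_deriv k f) (x - t *\<^sub>R axis k 1)) / 2"
        using second_diff_axis_mean_value[OF f(1) h(1)] by blast
      have "t < d k" using t h D(2)[of k] by linarith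
      then have "dist (x + t *\<^sub>R axis k 1) x < d k" "dist (x - t *\<^sub>R axis k 1) x < d k"
        using t by (auto simp: dist_norm)
      from this[THEN close] show ?thesis unfolding eq by (rule mean_close)
    qed
    then have "\<bar>second_diff h f x - laplacian f x\<bar> \<le> (\<Sum>k\<in>(UNIV :: 'a set). e / N)"
      unfolding second_diff_def laplacian_def sum_subtractf[symmetric]
      by (intro order_trans[OF sum_abs] sum_mono)
    then show ?thesis using N by (simp add: N_def)
  qed
  then show ?thesis using D(1) that by blast
qed

section \<open>Smoothing kernels and mollification\<close>

text \<open>The simplest function of class \<open>C\<^sup>2\<close> on the line that vanishes on a half line and is positive on the
  other. Bumps and cutoffs below are built from it; \<open>C\<^sup>2\<close> is all that test functions need.\<close>

definition pos_cube :: "real \<Rightarrow> real" where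
  "pos_cube t = (max 0 t) ^ 3"

lemma DERIV_max_power:
  "((\<lambda>t::real. (max 0 t) ^ (Suc (Suc n))) has_real_derivative real (Suc (Suc n)) * (max 0 t) ^ (Suc n)) (at t)"
proof -
  consider "t < 0" | "t > 0" | "t = 0" by linarith
  then show ?thesis
  proof cases
    case 1
    have "((\<lambda>t::real. 0) has_real_derivative 0) (at t)" by simp
    then have "((\<lambda>t::real. (max 0 t) ^ (Suc (Suc n))) has_real_derivative 0) (at t)"
      by (rule has_field_derivative_transform_within_open[of _ _ _ "{..<0}"]) (use 1 in auto)
    then show ?thesis using 1 by (simp add: max_def)
  next
    case 2
    have "((\<lambda>t::real. t ^ (Suc (Suc n))) has_real_derivative real (Suc (Suc n)) * t ^ (Suc n)) (at t)"
      using DERIV_pow[of "Suc (Suc n)" t] by simp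
    then have "((\<lambda>t::real. (max 0 t) ^ (Suc (Suc n))) has_real_derivative real (Suc (Suc n)) * t ^ (Suc n)) (at t)"
      by (rule has_field_derivative_transform_within_open[of _ _ _ "{0<..}"]) (use 2 in \<open>auto simp: max_def\<close>)
    then show ?thesis using 2 by (simp add: max_def)
  next
    case 3
    have "(\<lambda>h::real. (max 0 h) ^ (Suc (Suc n)) / h) \<midarrow>0\<rightarrow> 0"
    proof (rule Lim_null_comparison)
      have "norm ((max 0 h) ^ (Suc (Suc n)) / h) \<le> \<bar>h\<bar> ^ (Suc n)" for h :: real
        by (cases "h \<le> 0") (simp_all add: max.absorb1 max.absorb2 mult_nonpos_nonneg)
      then show "\<forall>\<^sub>F h in at 0. norm ((max 0 h) ^ (Suc (Suc n)) / h) \<le> \<bar>h\<bar> ^ (Suc n)"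
        by simp
      show "(\<lambda>h::real. \<bar>h\<bar> ^ (Suc n)) \<midarrow>0\<rightarrow> 0" by (auto intro!: tendsto_eq_intros)
    qed
    then show ?thesis using 3 by (simp add: DERIV_def)
  qed
qed

lemma DERIV_pos_cube: "(pos_cube has_real_derivative 3 * (max 0 t)\<^sup>2) (at t)"
  using DERIV_max_power[of 1 t] by (simp add: pos_cube_def[abs_def] numeral_3_eq_3 numeral_2_eq_2)

lemma DERIV_pos_cube': "((\<lambda>t. 3 * (max 0 t)\<^sup>2) has_real_derivative 6 * max 0 t) (at t)"
  using DERIV_cmult[OF DERIV_max_power[of 0 t], of 3] by (simp add: numeral_2_eq_2)

lemma pos_cube_nonneg: "0 \<le> pos_cube t"
  by (simp add: pos_cube_def)

lemma pos_cube_mono: "s \<le> t \<Longrightarrow> pos_cube s \<le> pos_cube t"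
  unfolding pos_cube_def by (intro power_mono) auto

lemma pos_cube_eq_0_iff: "pos_cube t = 0 \<longleftrightarrow> t \<le> 0"
  by (simp add: pos_cube_def max_def)

lemma Ck_on_pos_cube: "open U \<Longrightarrow> Ck_on 2 f U \<Longrightarrow> Ck_on 2 (\<lambda>x. pos_cube (f x)) U"
  by (rule Ck_on_2_compose[OF _ _ DERIV_pos_cube DERIV_pos_cube']) (auto intro!: continuous_intros)

lemma Ck_on_norm_sq: "open U \<Longrightarrow> Ck_on m (\<lambda>x. (norm (x - p))\<^sup>2 :: real) (U :: (real^'n::finite) set)"
proof -
  assume U: "open U"
  have "Ck_on m (\<lambda>x. \<Sum>k\<in>UNIV. (x $ k + - p $ k) * (x $ k + - p $ k)) U"
    by (intro Ck_on_sum Ck_on_mult Ck_on_add Ck_on_component Ck_on_const U)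
  moreover have "(norm (x - p))\<^sup>2 = (\<Sum>k\<in>UNIV. (x $ k + - p $ k) * (x $ k + - p $ k))" for x
    by (simp add: power2_norm_eq_inner inner_vec_def)
  ultimately show ?thesis by simp
qed

definition bump :: "real^'n::finite \<Rightarrow> real \<Rightarrow> real^'n \<Rightarrow> real" where
  "bump p r x = pos_cube (r\<^sup>2 - (norm (x - p))\<^sup>2)"

lemma Ck_on_bump: "open U \<Longrightarrow> Ck_on 2 (bump p r) U"
proof -
  assume U: "open U"
  have "Ck_on 2 (\<lambda>x. r\<^sup>2 + (- 1) * (norm (x - p))\<^sup>2) U"
    by (intro Ck_on_add Ck_on_mult Ck_on_const Ck_on_norm_sq U)
  from Ck_on_pos_cube[OF U this] show ?thesis by (simp add: bump_def[abs_def])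
qed

lemma bump_nonneg: "0 \<le> bump p r x"
  by (simp add: bump_def pos_cube_nonneg)

lemma bump_eq_0_iff: "r > 0 \<Longrightarrow> bump p r x = 0 \<longleftrightarrow> x \<notin> ball p r"
  by (simp add: bump_def pos_cube_eq_0_iff dist_norm norm_minus_commute not_less power2_le_iff_abs_le)

text \<open>A radially nonincreasing function is bounded below on the half ball by its value at distance \<open>r / 2\<close>.\<close>

lemma bump_lower_bound:
  assumes "r > 0"
  obtains c where "c > 0" "\<And>x. dist p x \<le> r / 2 \<Longrightarrow> c \<le> bump p r x"
proof (rule that[of "pos_cube (r\<^sup>2 - (r / 2)\<^sup>2)"])
  have "(r / 2)\<^sup>2 < r\<^sup>2" using assms by (intro power_strict_mono) auto
  then show "pos_cube (r\<^sup>2 - (r / 2)\<^sup>2) > 0"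
    using pos_cube_nonneg[of "r\<^sup>2 - (r / 2)\<^sup>2"] pos_cube_eq_0_iff[of "r\<^sup>2 - (r / 2)\<^sup>2"] by linarith
  fix x assume "dist p x \<le> r / 2"
  then have "(norm (x - p))\<^sup>2 \<le> (r / 2)\<^sup>2"
    by (intro power_mono) (simp_all add: dist_norm norm_minus_commute)
  then show "pos_cube (r\<^sup>2 - (r / 2)\<^sup>2) \<le> bump p r x" unfolding bump_def by (intro pos_cube_mono) simp
qed

lemma exists_smoothing_kernel:
  assumes "d > 0"
  obtains \<eta> :: "real^'n::finite \<Rightarrow> real" where "Ck_on 2 \<eta> UNIV" "\<And>z. 0 \<le> \<eta> z" "\<And>z. \<eta> z \<noteq> 0 \<Longrightarrow> norm z < d"
    "(\<integral>z. \<eta> z \<partial>lborel) = 1"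
proof -
  define b where "b = (bump 0 d :: real^'n \<Rightarrow> real)"
  have cont: "continuous_on UNIV b" unfolding b_def by (rule Ck_on_imp_continuous_on[OF Ck_on_bump[OF open_UNIV]])
  have supp: "b z \<noteq> 0 \<Longrightarrow> norm z < d" for z
    using bump_eq_0_iff[OF assms, of 0 z] by (simp add: b_def)
  then have "{z. b z \<noteq> 0} \<subseteq> ball 0 d" by auto
  then have bnd: "bounded {z. b z \<noteq> 0}" using bounded_ball bounded_subset by blast
  have int: "integrable lborel b" by (rule integrable_continuous_bounded_support[OF cont bnd])
  obtain c where c: "c > 0" "\<And>z. dist 0 z \<le> d / 2 \<Longrightarrow> c \<le> b z"
    using bump_lower_bound[OF assms, where p = "0 :: real^'n"] unfolding b_def by blast
  have "0 < c * measure lborel (ball (0::real^'n) (d/2))"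
    using c(1) assms content_ball_pos[of "d/2" "0::real^'n"] by simp
  also have "\<dots> = (\<integral>z. c * indicator (ball 0 (d/2)) z \<partial>(lborel :: (real^'n) measure))" by simp
  also have "\<dots> \<le> (\<integral>z. b z \<partial>lborel)"
  proof (rule integral_mono[OF _ int])
    show "integrable lborel (\<lambda>z. c * indicator (ball 0 (d/2)) z :: real)"
      using emeasure_bounded_finite[OF bounded_ball] by (intro integrable_mult_right) (simp add: integrable_indicator_iff)
    fix z :: "real^'n"
    have "c \<le> b z" if "norm z < d/2" using c(2)[of z] that by simp
    then show "c * indicator (ball 0 (d/2)) z \<le> b z"
      by (auto simp: indicator_def b_def bump_nonneg)
  qed
  finally have pos: "0 < (\<integral>z. b z \<partial>lborel)" .
  show ?thesis
  proof (rule that[of "\<lambda>z. (1 / (\<integral>z. b z \<partial>lborel)) * b z"])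
    show "Ck_on 2 (\<lambda>z. (1 / (\<integral>z. b z \<partial>lborel)) * b z) UNIV"
      unfolding b_def by (intro Ck_on_mult Ck_on_const Ck_on_bump open_UNIV)
    show "0 \<le> (1 / (\<integral>z. b z \<partial>lborel)) * b z" for z
      using pos bump_nonneg[of 0 d z] by (simp add: b_def)
    show "(1 / (\<integral>z. b z \<partial>lborel)) * b z \<noteq> 0 \<Longrightarrow> norm z < d" for z using supp[of z] by auto
    show "(\<integral>z. (1 / (\<integral>z. b z \<partial>lborel)) * b z \<partial>lborel) = 1" using pos by simp
  qed
qed

text \<open>The kernel is not reflected, so that \<open>mollify \<eta> f x\<close> is the pairing of \<open>f\<close> with the translate of \<open>\<eta>\<close> to
  \<open>x\<close>; this translate is what gets inserted as a test function.\<close>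

definition mollify :: "('a::euclidean_space \<Rightarrow> real) \<Rightarrow> ('a \<Rightarrow> real) \<Rightarrow> 'a \<Rightarrow> real" where
  "mollify \<eta> f x = (\<integral>y. f y * \<eta> (y - x) \<partial>lborel)"

lemma mollify_eq:
  assumes [measurable]: "f \<in> borel_measurable borel" "\<eta> \<in> borel_measurable borel"
  shows "mollify \<eta> f x = (\<integral>z. f (x + z) * \<eta> z \<partial>lborel)"
  unfolding mollify_def
  using integral_translate[of "\<lambda>y. f y * \<eta> (y - x)" x] by (simp add: add.commute)

lemma borel_measurable_mollify:
  assumes [measurable]: "f \<in> borel_measurable borel" "\<eta> \<in> borel_measurable borel"
  shows "mollify \<eta> f \<in> borel_measurable borel"
  unfolding mollify_def[abs_def] by measurable

text \<open>By Fubini, the error is at most the average of the translation modulus of \<open>f\<close> with weight \<open>\<eta>\<close>.\<close>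

lemma mollify_L1:
  fixes f \<eta> :: "'a::euclidean_space \<Rightarrow> real"
  assumes f: "integrable lborel f" and \<eta>: "integrable lborel \<eta>" "\<And>z. 0 \<le> \<eta> z" "(\<integral>z. \<eta> z \<partial>lborel) = 1"
    and bnd: "\<And>z. \<bar>\<eta> z\<bar> \<le> C"
    and e: "\<And>z. \<eta> z \<noteq> 0 \<Longrightarrow> (\<integral>x. \<bar>f (x + z) - f x\<bar> \<partial>lborel) \<le> e"
  shows "integrable lborel (mollify \<eta> f)" "(\<integral>x. \<bar>mollify \<eta> f x - f x\<bar> \<partial>lborel) \<le> e"
proof -
  have [measurable]: "f \<in> borel_measurable borel" "\<eta> \<in> borel_measurable borel" using f \<eta>(1) by auto
  define G where "G = (\<lambda>(z, x). (f (x + z) - f x) * \<eta> z)"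
  define T where "T z = (\<integral>x. \<bar>f (x + z) - f x\<bar> \<partial>lborel)" for z
  have T_meas[measurable]: "T \<in> borel_measurable borel"
    unfolding T_def[abs_def] by measurable
  have T0: "0 \<le> T z" for z by (simp add: T_def)
  have intfz: "integrable lborel (\<lambda>x. f (x + z) - f x)" for z
    using f integrable_translate[OF f, of z] by simp
  have normG: "(\<integral>x. norm (G (z, x)) \<partial>lborel) = T z * \<eta> z" for z
    using \<eta>(2)[of z] by (simp add: G_def T_def abs_mult)
  have Te: "T z * \<eta> z \<le> e * \<eta> z" for z
    using e[of z] \<eta>(2)[of z] by (cases "\<eta> z = 0") (auto simp: T_def intro: mult_right_mono)
  have iT: "integrable lborel (\<lambda>z. T z * \<eta> z)"
  proof (rule Bochner_Integration.integrable_bound)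
    show "integrable lborel (\<lambda>z. e * \<eta> z)" using \<eta>(1) by simp
    show "AE z in lborel. norm (T z * \<eta> z) \<le> norm (e * \<eta> z)"
      using Te T0 \<eta>(2) by (intro AE_I2) (simp add: abs_of_nonneg order_trans[OF _ abs_ge_self])
  qed simp
  have iG: "integrable (lborel \<Otimes>\<^sub>M lborel) G"
  proof (rule lborel_pair.Fubini_integrable)
    show "G \<in> borel_measurable (lborel \<Otimes>\<^sub>M lborel)" unfolding G_def by measurable
    show "integrable lborel (\<lambda>z. \<integral>x. norm (G (z, x)) \<partial>lborel)" unfolding normG by (rule iT)
    show "AE z in lborel. integrable lborel (\<lambda>x. G (z, x))"
      using intfz by (simp add: G_def)
  qed
  have m: "mollify \<eta> f x - f x = (\<integral>z. G (z, x) \<partial>lborel)" if "integrable lborel (\<lambda>z. G (z, x))" for x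
  proof -
    have "integrable lborel (\<lambda>z. G (z, x) + f x * \<eta> z)" using that \<eta>(1) by simp
    then have i: "integrable lborel (\<lambda>z. f (x + z) * \<eta> z)" by (simp add: G_def algebra_simps)
    have "(\<integral>z. G (z, x) \<partial>lborel) = (\<integral>z. f (x + z) * \<eta> z - f x * \<eta> z \<partial>lborel)"
      by (simp add: G_def algebra_simps)
    also have "\<dots> = mollify \<eta> f x - f x" using i \<eta>(1,3) by (simp add: mollify_eq)
    finally show ?thesis by simp
  qed
  have AEi: "AE x in lborel. integrable lborel (\<lambda>z. G (z, x))"
    using lborel_pair.AE_integrable_snd[of "\<lambda>z x. G (z, x)"] iG by simp
  have AEm: "AE x in lborel. mollify \<eta> f x - f x = (\<integral>z. G (z, x) \<partial>lborel)"
    using AEi by eventually_elim (rule m)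
  have isnd: "integrable lborel (\<lambda>x. \<integral>z. G (z, x) \<partial>lborel)"
    using lborel_pair.integrable_snd[of "\<lambda>z x. G (z, x)"] iG by simp
  have meas: "mollify \<eta> f \<in> borel_measurable lborel" by (simp add: borel_measurable_mollify)
  have id: "integrable lborel (\<lambda>x. mollify \<eta> f x - f x)"
    using isnd AEm meas f by (subst integrable_cong_AE[OF _ _ AEm]) auto
  then have "integrable lborel (\<lambda>x. (mollify \<eta> f x - f x) + f x)" using f by (intro Bochner_Integration.integrable_add)
  then show "integrable lborel (mollify \<eta> f)" by simp
  have iG': "integrable (lborel \<Otimes>\<^sub>M lborel) (\<lambda>p. norm (G p))" using iG by (rule integrable_norm)
  have "(\<integral>x. \<bar>mollify \<eta> f x - f x\<bar> \<partial>lborel) \<le> (\<integral>x. (\<integral>z. norm (G (z, x)) \<partial>lborel) \<partial>lborel)"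
  proof (rule integral_mono_AE)
    show "integrable lborel (\<lambda>x. \<bar>mollify \<eta> f x - f x\<bar>)" using id by simp
    show "integrable lborel (\<lambda>x. \<integral>z. norm (G (z, x)) \<partial>lborel)"
      using lborel_pair.integrable_snd[of "\<lambda>z x. norm (G (z, x))"] iG' by (simp add: case_prod_beta')
    show "AE x in lborel. \<bar>mollify \<eta> f x - f x\<bar> \<le> (\<integral>z. norm (G (z, x)) \<partial>lborel)"
      using AEm by eventually_elim (metis integral_norm_bound real_norm_def)
  qed
  also have "\<dots> = (\<integral>z. (\<integral>x. norm (G (z, x)) \<partial>lborel) \<partial>lborel)"
    using lborel_pair.Fubini_integral[of "\<lambda>z x. norm (G (z, x))"] iG' by (simp add: case_prod_beta')
  also have "\<dots> = (\<integral>z. T z * \<eta> z \<partial>lborel)" by (simp only: normG)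
  also have "\<dots> \<le> (\<integral>z. e * \<eta> z \<partial>lborel)"
    by (rule integral_mono[OF iT]) (use \<eta>(1) Te in auto)
  also have "\<dots> = e" using \<eta>(3) by simp
  finally show "(\<integral>x. \<bar>mollify \<eta> f x - f x\<bar> \<partial>lborel) \<le> e" .
qed

section \<open>Kato's inequality\<close>

text \<open>These are the functions in \<open>C2_c U\<close>, except that regularity is required on the whole space, where it
  holds automatically. Having it there lets integrals, derivatives and translates be taken over the whole space.\<close>

definition is_test_function :: "(real^'n::finite) set \<Rightarrow> (real^'n \<Rightarrow> real) \<Rightarrow> bool" where
  "is_test_function U \<phi> \<longleftrightarrow> Ck_on 2 \<phi> UNIV \<and> bounded {x. \<phi> x \<noteq> 0} \<and> closure {x. \<phi> x \<noteq> 0} \<subseteq> U"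

lemma mollify_abs_bound:
  fixes f \<eta> :: "'a::euclidean_space \<Rightarrow> real"
  assumes "integrable lborel f" "\<eta> \<in> borel_measurable borel" "\<And>z. \<bar>\<eta> z\<bar> \<le> e"
  shows "\<bar>mollify \<eta> f x\<bar> \<le> e * (\<integral>y. \<bar>f y\<bar> \<partial>lborel)"
proof -
  have [measurable]: "\<eta> \<in> borel_measurable borel" by fact
  have i: "integrable lborel (\<lambda>y. f y * \<eta> (y - x))"
    by (rule integrable_bounded_mult[OF assms(1) _ assms(3)]) simp
  have "\<bar>mollify \<eta> f x\<bar> \<le> (\<integral>y. \<bar>f y * \<eta> (y - x)\<bar> \<partial>lborel)"
    unfolding mollify_def by (rule integral_abs_bound)
  also have "\<dots> \<le> (\<integral>y. e * \<bar>f y\<bar> \<partial>lborel)"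
    using integrable_abs[OF i] assms(1) mult_right_mono[OF assms(3) abs_ge_zero]
    by (intro integral_mono) (auto simp: abs_mult mult.commute)
  finally show ?thesis by simp
qed

lemma mollify_diff:
  fixes f \<eta> \<theta> :: "'a::euclidean_space \<Rightarrow> real"
  assumes "integrable lborel f" "\<eta> \<in> borel_measurable borel" "\<And>z. \<bar>\<eta> z\<bar> \<le> C"
    "\<theta> \<in> borel_measurable borel" "\<And>z. \<bar>\<theta> z\<bar> \<le> D"
  shows "mollify (\<lambda>z. \<eta> z - \<theta> z) f x = mollify \<eta> f x - mollify \<theta> f x"
proof -
  have [measurable]: "\<eta> \<in> borel_measurable borel" "\<theta> \<in> borel_measurable borel" by fact+
  have "integrable lborel (\<lambda>y. f y * \<eta> (y - x))" "integrable lborel (\<lambda>y. f y * \<theta> (y - x))"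
    by (rule integrable_bounded_mult[OF assms(1) _ assms(3)] integrable_bounded_mult[OF assms(1) _ assms(5)]; simp)+
  then show ?thesis by (simp add: mollify_def right_diff_distrib)
qed

lemma second_diff_mollify:
  fixes f \<eta> :: "real^'n::finite \<Rightarrow> real"
  assumes "integrable lborel f" "\<eta> \<in> borel_measurable borel" "\<And>z. \<bar>\<eta> z\<bar> \<le> C"
  shows "second_diff h (mollify \<eta> f) x = mollify (second_diff h \<eta>) f x"
proof -
  have [measurable]: "\<eta> \<in> borel_measurable borel" by fact
  have i[simp]: "integrable lborel (\<lambda>y. f y * \<eta> (y - z))" for z
    by (rule integrable_bounded_mult[OF assms(1) _ assms(3)]) simp
  have i1[simp]: "integrable lborel (\<lambda>y. f y * \<eta> (y - x + h *\<^sub>R axis k 1))" for k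
    using i[of "x - h *\<^sub>R axis k 1"] by (simp add: algebra_simps)
  have i2[simp]: "integrable lborel (\<lambda>y. f y * \<eta> (y - x - h *\<^sub>R axis k 1))" for k
    using i[of "x + h *\<^sub>R axis k 1"] by (simp add: algebra_simps)
  have "mollify (second_diff h \<eta>) f x = (\<integral>y. (\<Sum>k\<in>UNIV. (f y * \<eta> (y - x + h *\<^sub>R axis k 1)
      + f y * \<eta> (y - x - h *\<^sub>R axis k 1) - 2 * (f y * \<eta> (y - x))) / h\<^sup>2) \<partial>lborel)"
    unfolding mollify_def second_diff_def
    by (intro Bochner_Integration.integral_cong refl)
       (simp add: sum_distrib_left algebra_simps add_divide_distrib diff_divide_distrib)
  also have "\<dots> = (\<Sum>k\<in>UNIV. ((\<integral>y. f y * \<eta> (y - x + h *\<^sub>R axis k 1) \<partial>lborel)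
      + (\<integral>y. f y * \<eta> (y - x - h *\<^sub>R axis k 1) \<partial>lborel) - 2 * (\<integral>y. f y * \<eta> (y - x) \<partial>lborel)) / h\<^sup>2)"
    by (subst Bochner_Integration.integral_sum) simp_all
  also have "\<dots> = second_diff h (mollify \<eta> f) x"
    unfolding second_diff_def mollify_def
    by (intro sum.cong refl) (simp add: algebra_simps)
  finally show ?thesis by simp
qed

text \<open>The discrete Laplacian is symmetric: translations preserve the integral, and the steps \<open>h\<close> and \<open>- h\<close>
  enter symmetrically. This takes the place of two integrations by parts.\<close>

lemma integral_second_diff:
  fixes f \<phi> :: "real^'n::finite \<Rightarrow> real"
  assumes "integrable lborel f" "\<phi> \<in> borel_measurable borel" "\<And>z. \<bar>\<phi> z\<bar> \<le> C"
  shows "integrable lborel (\<lambda>x. second_diff h f x * \<phi> x)"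
    "(\<integral>x. second_diff h f x * \<phi> x \<partial>lborel) = (\<integral>x. f x * second_diff h \<phi> x \<partial>lborel)"
proof -
  have [measurable]: "\<phi> \<in> borel_measurable borel" "f \<in> borel_measurable borel" using assms by auto
  have i1[simp]: "integrable lborel (\<lambda>x. f (x + z) * \<phi> x)" for z
    by (rule integrable_bounded_mult[OF integrable_translate[OF assms(1)] _ assms(3)]) simp
  have i1'[simp]: "integrable lborel (\<lambda>x. f (x - z) * \<phi> x)" for z using i1[of "- z"] by simp
  have i0[simp]: "integrable lborel (\<lambda>x. f x * \<phi> x)" using i1[of 0] by simp
  have i2[simp]: "integrable lborel (\<lambda>x. f x * \<phi> (x + z))" for z
    by (rule integrable_bounded_mult[OF assms(1) _ assms(3)]) simp
  have i2'[simp]: "integrable lborel (\<lambda>x. f x * \<phi> (x - z))" for z using i2[of "- z"] by simp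
  have shift: "(\<integral>x. f (x + z) * \<phi> x \<partial>lborel) = (\<integral>x. f x * \<phi> (x - z) \<partial>lborel)" for z
    using integral_translate[of "\<lambda>x. f x * \<phi> (x - z)" z] by simp
  have shift': "(\<integral>x. f (x - z) * \<phi> x \<partial>lborel) = (\<integral>x. f x * \<phi> (x + z) \<partial>lborel)" for z
    using shift[of "- z"] by simp
  have L: "second_diff h f x * \<phi> x = (\<Sum>k\<in>UNIV. (f (x + h *\<^sub>R axis k 1) * \<phi> x + f (x - h *\<^sub>R axis k 1) * \<phi> x
      - 2 * (f x * \<phi> x)) / h\<^sup>2)" for x
    unfolding second_diff_def sum_distrib_right
    by (intro sum.cong refl) (simp add: algebra_simps add_divide_distrib diff_divide_distrib)
  have R: "f x * second_diff h \<phi> x = (\<Sum>k\<in>UNIV. (f x * \<phi> (x + h *\<^sub>R axis k 1) + f x * \<phi> (x - h *\<^sub>R axis k 1)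
      - 2 * (f x * \<phi> x)) / h\<^sup>2)" for x
    unfolding second_diff_def sum_distrib_left
    by (intro sum.cong refl) (simp add: algebra_simps add_divide_distrib diff_divide_distrib)
  show "integrable lborel (\<lambda>x. second_diff h f x * \<phi> x)" unfolding L by simp
  show "(\<integral>x. second_diff h f x * \<phi> x \<partial>lborel) = (\<integral>x. f x * second_diff h \<phi> x \<partial>lborel)"
    unfolding L R by (simp add: Bochner_Integration.integral_sum shift shift' add.commute)
qed

text \<open>Kato's inequality is trivial for difference quotients: multiplication by \<open>sgn (f x)\<close> turns the value
  at \<open>x\<close> into its absolute value and every neighbouring value into at most its absolute value.\<close>

lemma second_diff_abs:
  assumes "h > 0"
  shows "sgn (f x) * second_diff h f x \<le> second_diff h (\<lambda>y. \<bar>f y\<bar>) x"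
proof -
  have s: "sgn (f x) * a \<le> \<bar>a\<bar>" "sgn (f x) * f x = \<bar>f x\<bar>" for a
    by (auto simp: sgn_if abs_if)
  have "sgn (f x) * second_diff h f x = (\<Sum>k\<in>UNIV. (sgn (f x) * f (x + h *\<^sub>R axis k 1)
      + sgn (f x) * f (x - h *\<^sub>R axis k 1) - 2 * (sgn (f x) * f x)) / h\<^sup>2)"
    unfolding second_diff_def sum_distrib_left
    by (intro sum.cong refl) (simp add: algebra_simps add_divide_distrib diff_divide_distrib)
  also have "\<dots> \<le> second_diff h (\<lambda>y. \<bar>f y\<bar>) x"
    unfolding second_diff_def s(2)
    by (intro sum_mono divide_right_mono diff_right_mono add_mono s(1)) auto
  finally show ?thesis .
qed

text \<open>The discrete inequality passes to the limit \<open>h \<rightarrow> 0\<close> because all differences fall either on the kernel or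
  on \<open>\<phi>\<close>, where the quotients converge uniformly. The function \<open>\<bar>mollify \<eta> f\<bar>\<close> itself is never
  differentiated, so no smooth approximation of the absolute value is needed.\<close>

lemma kato_mollified:
  fixes f \<eta> \<phi> :: "real^'n::finite \<Rightarrow> real"
  assumes f: "integrable lborel f" and \<eta>: "Ck_on 2 \<eta> UNIV" "bounded {x. \<eta> x \<noteq> 0}"
    and int: "integrable lborel (mollify \<eta> f)"
    and \<phi>: "Ck_on 2 \<phi> UNIV" "bounded {x. \<phi> x \<noteq> 0}" "\<And>x. 0 \<le> \<phi> x"
  shows "(\<integral>x. sgn (mollify \<eta> f x) * mollify (laplacian \<eta>) f x * \<phi> x \<partial>lborel)
    \<le> (\<integral>x. \<bar>mollify \<eta> f x\<bar> * laplacian \<phi> x \<partial>lborel)"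
proof -
  define u where "u = mollify \<eta> f"
  define v where "v = mollify (laplacian \<eta>) f"
  have iu: "integrable lborel u" using int by (simp add: u_def)
  then have iau: "integrable lborel (\<lambda>x. \<bar>u x\<bar>)" by simp
  have meas: "g \<in> borel_measurable borel" if "continuous_on UNIV g" for g :: "real^'n \<Rightarrow> real"
    using that by (rule borel_measurable_continuous_onI)
  note c\<eta> = C2_continuous[OF \<eta>(1)] and c\<phi> = C2_continuous[OF \<phi>(1)]
  note [measurable] = meas[OF c\<eta>(1)] meas[OF c\<eta>(4)] meas[OF c\<phi>(1)] meas[OF c\<phi>(4)]
  have [measurable]: "f \<in> borel_measurable borel" using f by simp
  obtain C1 where C1: "\<And>x. \<bar>\<eta> x\<bar> \<le> C1" using bounded_of_bounded_support[OF c\<eta>(1) \<eta>(2)] by blast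
  obtain C2 where C2: "\<And>x. \<bar>laplacian \<eta> x\<bar> \<le> C2"
    using bounded_of_bounded_support[OF c\<eta>(4) bounded_support_derivatives(3)[OF \<eta>(2)]] by blast
  obtain C3 where C3: "\<And>x. \<bar>\<phi> x\<bar> \<le> C3" using bounded_of_bounded_support[OF c\<phi>(1) \<phi>(2)] by blast
  obtain C4 where C4: "\<And>x. \<bar>laplacian \<phi> x\<bar> \<le> C4"
    using bounded_of_bounded_support[OF c\<phi>(4) bounded_support_derivatives(3)[OF \<phi>(2)]] by blast
  have i\<phi>: "integrable lborel \<phi>" by (rule integrable_continuous_bounded_support[OF c\<phi>(1) \<phi>(2)])
  have [measurable]: "u \<in> borel_measurable borel" "v \<in> borel_measurable borel"
    unfolding u_def v_def by (intro borel_measurable_mollify; measurable)+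
  have sgn_meas[measurable]: "(\<lambda>x. sgn (u x)) \<in> borel_measurable borel" by measurable
  define N where "N = (\<integral>x. \<phi> x \<partial>lborel)"
  define W where "W = (\<integral>x. \<bar>f x\<bar> \<partial>lborel)"
  define M where "M = (\<integral>x. \<bar>u x\<bar> \<partial>lborel)"
  have vbnd: "\<bar>v x\<bar> \<le> C2 * W" for x
    unfolding v_def W_def by (rule mollify_abs_bound[OF f _ C2]) simp
  have iv: "integrable lborel (\<lambda>x. \<phi> x * (sgn (u x) * v x))"
    by (rule integrable_bounded_mult[OF i\<phi>, where C = "C2 * W"])
       (use vbnd order_trans[OF abs_ge_zero vbnd] in \<open>auto simp: abs_mult sgn_if\<close>)
  have i4: "integrable lborel (\<lambda>x. \<bar>u x\<bar> * laplacian \<phi> x)"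
    by (rule integrable_bounded_mult[OF iau _ C4]) simp
  have key: "(\<integral>x. \<phi> x * (sgn (u x) * v x) \<partial>lborel) \<le> (\<integral>x. \<bar>u x\<bar> * laplacian \<phi> x \<partial>lborel) + e * (W * N + M)" if "e > 0" for e
  proof -
    obtain d1 where d1: "d1 > 0" "\<And>h x. 0 < h \<Longrightarrow> h < d1 \<Longrightarrow> \<bar>second_diff h \<eta> x - laplacian \<eta> x\<bar> \<le> e"
      using second_diff_uniform[OF \<eta> \<open>e > 0\<close>] by blast
    obtain d2 where d2: "d2 > 0" "\<And>h x. 0 < h \<Longrightarrow> h < d2 \<Longrightarrow> \<bar>second_diff h \<phi> x - laplacian \<phi> x\<bar> \<le> e"
      using second_diff_uniform[OF \<phi>(1,2) \<open>e > 0\<close>] by blast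
    define h where "h = min d1 d2 / 2"
    have h: "h > 0" "h < d1" "h < d2" using d1(1) d2(1) by (auto simp: h_def)
    have [measurable]: "second_diff h g \<in> borel_measurable borel" if [measurable]: "g \<in> borel_measurable borel" for g :: "real^'n \<Rightarrow> real"
      unfolding second_diff_def[abs_def] by measurable
    have sd\<eta>: "\<bar>second_diff h \<eta> z\<bar> \<le> C2 + e" for z
      using d1(2)[OF h(1,2), of z] C2[of z] by linarith
    have sd\<phi>: "\<bar>second_diff h \<phi> z\<bar> \<le> C4 + e" for z
      using d2(2)[OF h(1,3), of z] C4[of z] by linarith
    \<comment> \<open>Differences of \<open>u\<close> fall on the kernel.\<close>
    have uv: "\<bar>second_diff h u x - v x\<bar> \<le> e * W" for x
    proof -
      have "second_diff h u x - v x = mollify (\<lambda>z. second_diff h \<eta> z - laplacian \<eta> z) f x"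
        unfolding u_def v_def
        by (subst mollify_diff[OF f _ sd\<eta> _ C2]) (simp_all add: second_diff_mollify[OF f _ C1])
      then show ?thesis
        using mollify_abs_bound[of f "\<lambda>z. second_diff h \<eta> z - laplacian \<eta> z" e x] f d1(2)[OF h(1,2)]
        by (simp add: W_def)
    qed
    have s: "\<phi> x * (sgn (u x) * v x) \<le> second_diff h (\<lambda>y. \<bar>u y\<bar>) x * \<phi> x + e * W * \<phi> x" for x
    proof -
      have "sgn (u x) * v x \<le> sgn (u x) * second_diff h u x + e * W"
        using uv[of x] order_trans[OF abs_ge_zero uv[of x]] by (auto simp: sgn_if abs_le_iff)
      also have "\<dots> \<le> second_diff h (\<lambda>y. \<bar>u y\<bar>) x + e * W"
        using second_diff_abs[OF h(1), where f = u and x = x] by simp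
      finally have "sgn (u x) * v x \<le> second_diff h (\<lambda>y. \<bar>u y\<bar>) x + e * W" .
      from mult_right_mono[OF this \<phi>(3)[of x]] show ?thesis by (simp add: algebra_simps)
    qed
    have "(\<integral>x. \<phi> x * (sgn (u x) * v x) \<partial>lborel) \<le> (\<integral>x. second_diff h (\<lambda>y. \<bar>u y\<bar>) x * \<phi> x + e * W * \<phi> x \<partial>lborel)"
      using integral_second_diff(1)[OF iau _ C3] i\<phi>
      by (intro integral_mono[OF iv _ s] Bochner_Integration.integrable_add) auto
    also have "\<dots> = (\<integral>x. \<bar>u x\<bar> * second_diff h \<phi> x \<partial>lborel) + e * W * N"
      using integral_second_diff[where h = h, OF iau _ C3] i\<phi> by (simp add: N_def)
    also have "(\<integral>x. \<bar>u x\<bar> * second_diff h \<phi> x \<partial>lborel) \<le> (\<integral>x. \<bar>u x\<bar> * laplacian \<phi> x + e * \<bar>u x\<bar> \<partial>lborel)"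
    proof (rule integral_mono)
      show "integrable lborel (\<lambda>x. \<bar>u x\<bar> * second_diff h \<phi> x)"
        by (rule integrable_bounded_mult[OF iau _ sd\<phi>]) simp
      show "integrable lborel (\<lambda>x. \<bar>u x\<bar> * laplacian \<phi> x + e * \<bar>u x\<bar>)" using i4 iau by simp
      fix x
      have "second_diff h \<phi> x \<le> laplacian \<phi> x + e" using d2(2)[OF h(1,3), of x] by linarith
      from mult_left_mono[OF this abs_ge_zero[of "u x"]]
      show "\<bar>u x\<bar> * second_diff h \<phi> x \<le> \<bar>u x\<bar> * laplacian \<phi> x + e * \<bar>u x\<bar>" by (simp add: algebra_simps)
    qed
    also have "\<dots> = (\<integral>x. \<bar>u x\<bar> * laplacian \<phi> x \<partial>lborel) + e * M" using i4 iau by (simp add: M_def)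
    finally show ?thesis by (simp add: algebra_simps)
  qed
  have "(\<integral>x. \<phi> x * (sgn (u x) * v x) \<partial>lborel) \<le> (\<integral>x. \<bar>u x\<bar> * laplacian \<phi> x \<partial>lborel)"
  proof (rule field_le_epsilon)
    fix e :: real assume "e > 0"
    \<comment> \<open>The summand 1 only makes \<open>A\<close> positive.\<close>
    define A where "A = \<bar>W * N + M\<bar> + 1"
    have A: "A > 0" by (simp add: A_def)
    have "e / A * (W * N + M) \<le> e / A * A"
      using A \<open>e > 0\<close> by (intro mult_left_mono) (auto simp: A_def)
    then show "(\<integral>x. \<phi> x * (sgn (u x) * v x) \<partial>lborel) \<le> (\<integral>x. \<bar>u x\<bar> * laplacian \<phi> x \<partial>lborel) + e"
      using key[of "e / A"] A \<open>e > 0\<close> by simp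
  qed
  then show ?thesis by (simp add: u_def v_def mult.commute mult.left_commute)
qed

lemma is_test_functionD:
  assumes "is_test_function U \<phi>"
  shows "Ck_on 2 \<phi> UNIV" "bounded {x. \<phi> x \<noteq> 0}" "compact (closure {x. \<phi> x \<noteq> 0})" "closure {x. \<phi> x \<noteq> 0} \<subseteq> U"
  using assms by (auto simp: is_test_function_def compact_closure)

lemma is_test_function_translate:
  fixes \<eta> :: "real^'n::finite \<Rightarrow> real"
  assumes "Ck_on 2 \<eta> UNIV" "\<And>z. \<eta> z \<noteq> 0 \<Longrightarrow> norm z < d" "cball x d \<subseteq> U"
  shows "is_test_function U (\<lambda>y. \<eta> (y - x))"
proof -
  have sub: "{y. \<eta> (y - x) \<noteq> 0} \<subseteq> cball x d"
  proof
    fix y assume "y \<in> {y. \<eta> (y - x) \<noteq> 0}"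
    then show "y \<in> cball x d" using assms(2)[of "y - x"] by (simp add: dist_norm norm_minus_commute)
  qed
  then have "closure {y. \<eta> (y - x) \<noteq> 0} \<subseteq> cball x d" by (simp add: closure_minimal)
  then show ?thesis
    using assms(3) Ck_on_translate[OF assms(1)] bounded_subset[OF bounded_cball sub]
    by (auto simp: is_test_function_def)
qed

text \<open>Let \<open>\<Delta> W = F\<close> weakly in \<open>U\<close>, where \<open>F\<close> has the sign of \<open>W\<close>. Then \<open>\<bar>W\<bar>\<close> is weakly subharmonic. Near the
  support of \<open>\<phi>\<close>, the Laplacian of a mollification of \<open>W\<close> is the mollification of \<open>F\<close>, as the translated
  kernel is a test function there. So the previous lemma bounds the integral of \<open>sgn w * f * \<phi>\<close> by that
  of \<open>\<bar>w\<bar> * \<Delta> \<phi>\<close> for mollifications \<open>w\<close>, \<open>f\<close> of \<open>W\<close>, \<open>F\<close>. As these converge in \<open>L\<^sup>1\<close>, and along a subsequence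
  \<open>w\<close> converges almost everywhere, the limit of the left hand side is the integral of the nonnegative
  function \<open>sgn W * F * \<phi>\<close>. The discontinuity of \<open>sgn\<close> at zero does no harm because \<open>F\<close> vanishes where \<open>W\<close>
  does.\<close>

lemma kato_inequality:
  fixes W F \<phi> :: "real^'n::finite \<Rightarrow> real"
  assumes U: "open U" and W: "integrable lborel W" and F: "integrable lborel F"
    and eq: "\<And>\<psi>. is_test_function U \<psi> \<Longrightarrow> (\<integral>x. W x * laplacian \<psi> x \<partial>lborel) = (\<integral>x. F x * \<psi> x \<partial>lborel)"
    and sign: "AE x in lborel. 0 \<le> W x * F x" and zero: "AE x in lborel. W x = 0 \<longrightarrow> F x = 0"
    and \<phi>: "is_test_function U \<phi>" "\<And>x. 0 \<le> \<phi> x"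
  shows "0 \<le> (\<integral>x. \<bar>W x\<bar> * laplacian \<phi> x \<partial>lborel)"
proof -
  note \<phi>D = is_test_functionD[OF \<phi>(1)]
  note c\<phi> = C2_continuous[OF \<phi>D(1)]
  have meas: "g \<in> borel_measurable borel" if "continuous_on UNIV g" for g :: "real^'n \<Rightarrow> real"
    using that by (rule borel_measurable_continuous_onI)
  note [measurable] = meas[OF c\<phi>(1)] meas[OF c\<phi>(4)]
  have [measurable]: "W \<in> borel_measurable borel" "F \<in> borel_measurable borel" using W F by auto
  obtain C where C: "\<And>x. \<bar>\<phi> x\<bar> \<le> C" using bounded_of_bounded_support[OF c\<phi>(1) \<phi>D(2)] by blast
  obtain L where L: "\<And>x. \<bar>laplacian \<phi> x\<bar> \<le> L"
    using bounded_of_bounded_support[OF c\<phi>(4) bounded_support_derivatives(3)[OF \<phi>D(2)]] by blast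
  obtain r where r: "r > 0" "(\<Union>x\<in>closure {x. \<phi> x \<noteq> 0}. cball x r) \<subseteq> U"
    using compact_subset_open_imp_cball_epsilon_subset[OF \<phi>D(3) U \<phi>D(4)] by blast
  define \<epsilon> where "\<epsilon> n = 1 / real (Suc n)" for n
  have \<epsilon>: "\<epsilon> n > 0" for n by (simp add: \<epsilon>_def)
  have \<epsilon>0: "\<epsilon> \<longlonglongrightarrow> 0" unfolding \<epsilon>_def[abs_def] by (rule LIMSEQ_Suc[OF lim_1_over_n])
  have modulus: "\<exists>d>0. \<forall>z. norm z < d \<longrightarrow> (\<integral>x. \<bar>f (x + z) - f x\<bar> \<partial>lborel) \<le> e"
    if f: "integrable lborel f" and "e > 0" for f :: "real^'n \<Rightarrow> real" and e
  proof -
    have "\<forall>\<^sub>F z in at 0. dist (\<integral>x. \<bar>f (x + z) - f x\<bar> \<partial>lborel) 0 < e"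
      using translation_continuous_L1[OF f] \<open>e > 0\<close> by (rule tendstoD)
    then obtain d where "d > 0" and d: "\<And>z. z \<noteq> 0 \<Longrightarrow> norm z < d \<Longrightarrow> (\<integral>x. \<bar>f (x + z) - f x\<bar> \<partial>lborel) < e"
      unfolding eventually_at by (auto simp: dist_norm)
    have "(\<integral>x. \<bar>f (x + z) - f x\<bar> \<partial>lborel) \<le> e" if "norm z < d" for z
      using d[of z] that \<open>e > 0\<close> by (cases "z = 0") auto
    with \<open>d > 0\<close> show ?thesis by blast
  qed
  have "\<exists>\<eta>. Ck_on 2 \<eta> UNIV \<and> (\<forall>z. 0 \<le> \<eta> z) \<and> (\<integral>z. \<eta> z \<partial>lborel) = 1 \<and>
     (\<forall>z. \<eta> z \<noteq> 0 \<longrightarrow> norm z < r \<and> (\<integral>x. \<bar>W (x + z) - W x\<bar> \<partial>lborel) \<le> \<epsilon> n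
        \<and> (\<integral>x. \<bar>F (x + z) - F x\<bar> \<partial>lborel) \<le> \<epsilon> n)" for n
  proof -
    obtain d1 where d1: "d1 > 0" "\<And>z. norm z < d1 \<Longrightarrow> (\<integral>x. \<bar>W (x + z) - W x\<bar> \<partial>lborel) \<le> \<epsilon> n"
      using modulus[OF W \<epsilon>] by blast
    obtain d2 where d2: "d2 > 0" "\<And>z. norm z < d2 \<Longrightarrow> (\<integral>x. \<bar>F (x + z) - F x\<bar> \<partial>lborel) \<le> \<epsilon> n"
      using modulus[OF F \<epsilon>] by blast
    obtain \<eta> :: "real^'n \<Rightarrow> real" where "Ck_on 2 \<eta> UNIV" "\<And>z. 0 \<le> \<eta> z" "\<And>z. \<eta> z \<noteq> 0 \<Longrightarrow> norm z < min r (min d1 d2)"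
      "(\<integral>z. \<eta> z \<partial>lborel) = 1"
      using exists_smoothing_kernel[of "min r (min d1 d2)"] r(1) d1(1) d2(1) by auto
    then show ?thesis using d1(2) d2(2) by (intro exI[of _ \<eta>]) auto
  qed
  then have "\<exists>\<eta>. \<forall>n. Ck_on 2 (\<eta> n) UNIV \<and> (\<forall>z. 0 \<le> \<eta> n z) \<and> (\<integral>z. \<eta> n z \<partial>lborel) = 1 \<and>
     (\<forall>z. \<eta> n z \<noteq> 0 \<longrightarrow> norm z < r \<and> (\<integral>x. \<bar>W (x + z) - W x\<bar> \<partial>lborel) \<le> \<epsilon> n
        \<and> (\<integral>x. \<bar>F (x + z) - F x\<bar> \<partial>lborel) \<le> \<epsilon> n)"
    by (intro choice allI)
  then obtain \<eta> where \<eta>: "\<And>n. Ck_on 2 (\<eta> n) UNIV" "\<And>n z. 0 \<le> \<eta> n z" "\<And>n. (\<integral>z. \<eta> n z \<partial>lborel) = 1"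
    "\<And>n z. \<eta> n z \<noteq> 0 \<Longrightarrow> norm z < r"
    "\<And>n z. \<eta> n z \<noteq> 0 \<Longrightarrow> (\<integral>x. \<bar>W (x + z) - W x\<bar> \<partial>lborel) \<le> \<epsilon> n"
    "\<And>n z. \<eta> n z \<noteq> 0 \<Longrightarrow> (\<integral>x. \<bar>F (x + z) - F x\<bar> \<partial>lborel) \<le> \<epsilon> n"
    by blast
  have b\<eta>: "bounded {z. \<eta> n z \<noteq> 0}" for n
    by (rule bounded_subset[OF bounded_ball[of 0 r]]) (use \<eta>(4) in auto)
  have c\<eta>: "continuous_on UNIV (\<eta> n)" for n by (rule C2_continuous(1)[OF \<eta>(1)])
  have i\<eta>: "integrable lborel (\<eta> n)" for n
    by (rule integrable_continuous_bounded_support[OF c\<eta> b\<eta>])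
  have [measurable]: "\<eta> n \<in> borel_measurable borel" for n using meas[OF c\<eta>] .
  have "\<exists>C. \<forall>z. \<bar>\<eta> n z\<bar> \<le> C" for n
    using bounded_of_bounded_support[OF c\<eta> b\<eta>] by metis
  then obtain B where B: "\<And>n z. \<bar>\<eta> n z\<bar> \<le> B n" by metis
  define w where "w n = mollify (\<eta> n) W" for n
  define f where "f n = mollify (\<eta> n) F" for n
  have w: "integrable lborel (w n)" "(\<integral>x. \<bar>w n x - W x\<bar> \<partial>lborel) \<le> \<epsilon> n" for n
    unfolding w_def using mollify_L1[OF W i\<eta> \<eta>(2,3) B \<eta>(5)] by blast+
  have f: "integrable lborel (f n)" "(\<integral>x. \<bar>f n x - F x\<bar> \<partial>lborel) \<le> \<epsilon> n" for n
    unfolding f_def using mollify_L1[OF F i\<eta> \<eta>(2,3) B \<eta>(6)] by blast+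
  have [measurable]: "w n \<in> borel_measurable borel" "f n \<in> borel_measurable borel" for n
    using w(1) f(1) by auto
  \<comment> \<open>Where \<open>\<phi>\<close> vanishes there is nothing to prove, and elsewhere the translated kernel is supported in \<open>U\<close>.\<close>
  have local_eq: "mollify (laplacian (\<eta> n)) W x * \<phi> x = f n x * \<phi> x" for n x
  proof (cases "\<phi> x = 0")
    case False
    then have "cball x r \<subseteq> U" using r(2) closure_subset[of "{x. \<phi> x \<noteq> 0}"] by blast
    from eq[OF is_test_function_translate[OF \<eta>(1)[of n] \<eta>(4)[of n] this]]
    show ?thesis by (simp add: mollify_def f_def laplacian_translate)
  qed simp
  have bs: "\<bar>sgn (a::real) * \<phi> x\<bar> \<le> C" for a x
    using C[of x] order_trans[OF abs_ge_zero C] by (auto simp: sgn_if)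
  have iW: "integrable lborel (\<lambda>x. \<bar>W x\<bar> * laplacian \<phi> x)"
    using integrable_bounded_mult[OF integrable_abs[OF W] _ L] by simp
  have iw: "integrable lborel (\<lambda>x. \<bar>w n x\<bar> * laplacian \<phi> x)" for n
    using integrable_bounded_mult[OF integrable_abs[OF w(1)] _ L] by simp
  have iF: "integrable lborel (\<lambda>x. F x * (sgn (w n x) * \<phi> x))" for n
    by (rule integrable_bounded_mult[OF F _ bs]) measurable
  have i_f: "integrable lborel (\<lambda>x. f n x * (sgn (w n x) * \<phi> x))" for n
    by (rule integrable_bounded_mult[OF f(1) _ bs]) measurable
  \<comment> \<open>The kernel of index \<open>n\<close> is supported so close to 0 that both mollifications have \<open>L\<^sup>1\<close> error at most \<open>\<epsilon> n\<close>.\<close>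
  have bound: "(\<integral>x. F x * (sgn (w n x) * \<phi> x) \<partial>lborel) \<le> (\<integral>x. \<bar>W x\<bar> * laplacian \<phi> x \<partial>lborel) + (C + L) * \<epsilon> n" for n
  proof -
    have "(\<integral>x. f n x * (sgn (w n x) * \<phi> x) \<partial>lborel) \<le> (\<integral>x. \<bar>w n x\<bar> * laplacian \<phi> x \<partial>lborel)"
    proof -
      have "(\<integral>x. f n x * (sgn (w n x) * \<phi> x) \<partial>lborel) = (\<integral>x. sgn (w n x) * (mollify (laplacian (\<eta> n)) W x * \<phi> x) \<partial>lborel)"
        unfolding local_eq by (simp add: algebra_simps)
      also have "\<dots> \<le> (\<integral>x. \<bar>w n x\<bar> * laplacian \<phi> x \<partial>lborel)"
        using kato_mollified[OF W \<eta>(1) b\<eta> w(1)[of n, unfolded w_def] \<phi>D(1,2) \<phi>(2)]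
        by (simp add: w_def mult.assoc)
      finally show ?thesis .
    qed
    moreover have "(\<integral>x. F x * (sgn (w n x) * \<phi> x) \<partial>lborel) \<le> (\<integral>x. f n x * (sgn (w n x) * \<phi> x) \<partial>lborel) + C * \<epsilon> n"
    proof -
      have "(\<integral>x. F x * (sgn (w n x) * \<phi> x) \<partial>lborel) \<le> (\<integral>x. f n x * (sgn (w n x) * \<phi> x) + C * \<bar>f n x - F x\<bar> \<partial>lborel)"
      proof (rule integral_mono[OF iF])
        show "integrable lborel (\<lambda>x. f n x * (sgn (w n x) * \<phi> x) + C * \<bar>f n x - F x\<bar>)"
          using i_f f(1) F by simp
        fix x
        have "(F x - f n x) * (sgn (w n x) * \<phi> x) \<le> \<bar>f n x - F x\<bar> * \<bar>sgn (w n x) * \<phi> x\<bar>"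
          by (metis abs_ge_self abs_minus_commute abs_mult)
        also have "\<dots> \<le> \<bar>f n x - F x\<bar> * C" by (intro mult_left_mono bs) simp
        finally show "F x * (sgn (w n x) * \<phi> x) \<le> f n x * (sgn (w n x) * \<phi> x) + C * \<bar>f n x - F x\<bar>"
          by (simp add: algebra_simps)
      qed
      also have "\<dots> = (\<integral>x. f n x * (sgn (w n x) * \<phi> x) \<partial>lborel) + C * (\<integral>x. \<bar>f n x - F x\<bar> \<partial>lborel)"
        using i_f f(1) F by simp
      also have "\<dots> \<le> (\<integral>x. f n x * (sgn (w n x) * \<phi> x) \<partial>lborel) + C * \<epsilon> n"
        using f(2)[of n] order_trans[OF abs_ge_zero C] by (intro add_left_mono mult_left_mono) auto
      finally show ?thesis .
    qed
    moreover have "(\<integral>x. \<bar>w n x\<bar> * laplacian \<phi> x \<partial>lborel) \<le> (\<integral>x. \<bar>W x\<bar> * laplacian \<phi> x \<partial>lborel) + L * \<epsilon> n"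
    proof -
      have "(\<integral>x. \<bar>w n x\<bar> * laplacian \<phi> x \<partial>lborel) \<le> (\<integral>x. \<bar>W x\<bar> * laplacian \<phi> x + L * \<bar>w n x - W x\<bar> \<partial>lborel)"
      proof (rule integral_mono[OF iw])
        show "integrable lborel (\<lambda>x. \<bar>W x\<bar> * laplacian \<phi> x + L * \<bar>w n x - W x\<bar>)"
          using iW w(1) W by simp
        fix x
        have "(\<bar>w n x\<bar> - \<bar>W x\<bar>) * laplacian \<phi> x \<le> \<bar>\<bar>w n x\<bar> - \<bar>W x\<bar>\<bar> * \<bar>laplacian \<phi> x\<bar>"
          by (metis abs_ge_self abs_mult)
        also have "\<dots> \<le> \<bar>w n x - W x\<bar> * L" by (intro mult_mono L abs_triangle_ineq3) auto
        finally show "\<bar>w n x\<bar> * laplacian \<phi> x \<le> \<bar>W x\<bar> * laplacian \<phi> x + L * \<bar>w n x - W x\<bar>"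
          by (simp add: algebra_simps)
      qed
      also have "\<dots> = (\<integral>x. \<bar>W x\<bar> * laplacian \<phi> x \<partial>lborel) + L * (\<integral>x. \<bar>w n x - W x\<bar> \<partial>lborel)"
        using iW w(1) W by simp
      also have "\<dots> \<le> (\<integral>x. \<bar>W x\<bar> * laplacian \<phi> x \<partial>lborel) + L * \<epsilon> n"
        using w(2)[of n] order_trans[OF abs_ge_zero L] by (intro add_left_mono mult_left_mono) auto
      finally show ?thesis .
    qed
    ultimately show ?thesis by (simp add: algebra_simps)
  qed
  have "(\<lambda>n. \<integral>x. norm (w n x - W x) \<partial>lborel) \<longlonglongrightarrow> 0"
    using w(2) by (intro tendsto_sandwich[OF _ _ tendsto_const \<epsilon>0]) auto
  then obtain k where k: "strict_mono k" "AE x in lborel. (\<lambda>n. w (k n) x - W x) \<longlonglongrightarrow> 0"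
    using tendsto_L1_AE_subseq[of lborel "\<lambda>n x. w n x - W x"] w(1) W by auto
  have lim: "(\<lambda>n. \<integral>x. F x * (sgn (w (k n) x) * \<phi> x) \<partial>lborel) \<longlonglongrightarrow> (\<integral>x. F x * (sgn (W x) * \<phi> x) \<partial>lborel)"
  proof (rule integral_dominated_convergence[where w = "\<lambda>x. \<bar>F x\<bar> * C"])
    show "AE x in lborel. (\<lambda>n. F x * (sgn (w (k n) x) * \<phi> x)) \<longlonglongrightarrow> F x * (sgn (W x) * \<phi> x)"
      using k(2) zero
    proof eventually_elim
      case (elim x)
      then have "(\<lambda>n. w (k n) x) \<longlonglongrightarrow> W x" by (simp add: LIM_zero_iff)
      then show ?case using elim(2)
        by (cases "W x = 0") (auto intro!: tendsto_intros)
    qed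
    show "AE x in lborel. norm (F x * (sgn (w (k n) x) * \<phi> x)) \<le> \<bar>F x\<bar> * C" for n
      using mult_left_mono[OF bs abs_ge_zero] by (simp add: abs_mult[of "F _"])
  qed (use F in auto)
  have pos: "0 \<le> (\<integral>x. F x * (sgn (W x) * \<phi> x) \<partial>lborel)"
  proof (rule integral_nonneg_AE)
    show "AE x in lborel. 0 \<le> F x * (sgn (W x) * \<phi> x)"
      using sign
    proof eventually_elim
      case (elim x)
      then have "0 \<le> F x * sgn (W x)" by (auto simp: sgn_if zero_le_mult_iff)
      then show ?case using \<phi>(2)[of x] by (simp add: mult.assoc[symmetric])
    qed
  qed
  have "(\<lambda>n. (\<integral>x. \<bar>W x\<bar> * laplacian \<phi> x \<partial>lborel) + (C + L) * \<epsilon> (k n)) \<longlonglongrightarrow> (\<integral>x. \<bar>W x\<bar> * laplacian \<phi> x \<partial>lborel) + (C + L) * 0"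
    by (intro tendsto_intros LIMSEQ_subseq_LIMSEQ[OF \<epsilon>0 k(1), unfolded o_def])
  then have "(\<integral>x. F x * (sgn (W x) * \<phi> x) \<partial>lborel) \<le> (\<integral>x. \<bar>W x\<bar> * laplacian \<phi> x \<partial>lborel) + (C + L) * 0"
    using bound by (intro LIMSEQ_le[OF lim]) auto
  with pos show ?thesis by simp
qed

section \<open>Barriers at the boundary\<close>

lemma Ck_on_bump_mult:
  assumes U: "open U" "cball p r \<subseteq> U" and "r > 0" and f: "Ck_on 2 f U"
  shows "Ck_on 2 (\<lambda>x. bump p r x * f x) UNIV"
proof -
  have 1: "Ck_on 2 (\<lambda>x. bump p r x * f x) U" by (intro Ck_on_mult Ck_on_bump U f)
  have 2: "Ck_on 2 (\<lambda>x. bump p r x * f x) (- cball p r)"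
  proof (rule Ck_on_cong_imp[of _ "\<lambda>x. 0"])
    fix x assume "x \<in> - cball p r"
    then have "x \<notin> ball p r" by auto
    then show "0 = bump p r x * f x" using bump_eq_0_iff[OF \<open>r > 0\<close>, of p x] by simp
  qed (auto intro: Ck_on_const)
  have "U \<union> - cball p r = UNIV" using U(2) by auto
  then show ?thesis using Ck_on_Un[OF U(1) _ 1 2] by (simp add: open_Compl)
qed

text \<open>The segment from a point inside to a point outside crosses the boundary.\<close>

lemma infdist_frontier_le:
  fixes \<Omega> :: "'a::euclidean_space set"
  assumes "open \<Omega>" "x \<in> \<Omega>" "y \<notin> \<Omega>"
  shows "infdist x (frontier \<Omega>) \<le> dist x y"
proof -
  have "connected (closed_segment x y)" by simp
  then have "closed_segment x y \<inter> frontier \<Omega> \<noteq> {}"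
    using assms(2,3) by (intro connected_Int_frontier) auto
  then obtain z where z: "z \<in> closed_segment x y" "z \<in> frontier \<Omega>" by blast
  then have "infdist x (frontier \<Omega>) \<le> dist x z" by (intro infdist_le)
  also have "\<dots> \<le> dist x y" using z(1) by (metis dist_commute dist_in_closed_segment)
  finally show ?thesis .
qed

text \<open>The factor \<open>s\<close> is the sign of the derivative at \<open>p\<close>.\<close>

lemma axis_derivative_lower_bound:
  fixes \<rho> :: "real^'n::finite \<Rightarrow> real"
  assumes \<rho>: "Ck_on 2 \<rho> U" and U: "open U" "p \<in> U" and k: "partial_deriv k \<rho> p \<noteq> 0"
  shows "\<exists>s a r. \<bar>s\<bar> = 1 \<and> a > 0 \<and> r > 0 \<and> cball p r \<subseteq> U \<and>
    (\<forall>x\<in>cball p r. s * partial_deriv k \<rho> x \<ge> a)"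
proof -
  define s where "s = sgn (partial_deriv k \<rho> p)"
  define a where "a = \<bar>partial_deriv k \<rho> p\<bar> / 2"
  have s: "\<bar>s\<bar> = 1" "s * partial_deriv k \<rho> p = 2 * a" "a > 0" using k by (auto simp: s_def a_def sgn_if abs_if)
  have "continuous_on U (\<lambda>x. s * partial_deriv k \<rho> x)" using C2_continuous(2)[OF \<rho>] by (intro continuous_intros)
  then have "open (U \<inter> (\<lambda>x. s * partial_deriv k \<rho> x) -` {a<..})"
    using U(1) by (subst Int_commute) (simp add: continuous_on_open_vimage)
  moreover have "p \<in> U \<inter> (\<lambda>x. s * partial_deriv k \<rho> x) -` {a<..}" using U s by simp
  ultimately obtain r where "r > 0" "cball p r \<subseteq> U \<inter> (\<lambda>x. s * partial_deriv k \<rho> x) -` {a<..}"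
    using open_contains_cball by blast
  then have "r > 0 \<and> cball p r \<subseteq> U \<and> (\<forall>x\<in>cball p r. s * partial_deriv k \<rho> x \<ge> a)"
    by (auto intro: less_imp_le)
  with s(1,3) show ?thesis by blast
qed

text \<open>The mean value theorem along the axis: the function \<open>q\<close> in the proof has nonnegative derivative.\<close>

lemma axis_growth:
  fixes \<rho> :: "real^'n::finite \<Rightarrow> real"
  assumes \<rho>: "Ck_on 2 \<rho> U" and U: "open U" "cball p r \<subseteq> U" and s: "\<bar>s\<bar> = 1"
    and lower: "\<And>x. x \<in> cball p r \<Longrightarrow> s * partial_deriv k \<rho> x \<ge> a"
    and x: "dist p x + t \<le> r" and t: "t \<ge> 0"
  shows "\<rho> (x + (t * s) *\<^sub>R axis k 1) \<ge> \<rho> x + a * t"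
proof -
  \<comment> \<open>Subtracting the linear lower bound turns the claim into monotonicity.\<close>
  define q where "q \<tau> = \<rho> (x + (\<tau> * s) *\<^sub>R axis k 1) - a * \<tau>" for \<tau>
  have in_ball: "x + (\<tau> * s) *\<^sub>R axis k 1 \<in> cball p r" if "0 \<le> \<tau>" "\<tau> \<le> t" for \<tau>
  proof -
    have "dist p (x + (\<tau> * s) *\<^sub>R axis k 1) \<le> dist p x + dist x (x + (\<tau> * s) *\<^sub>R axis k 1)"
      by (rule dist_triangle)
    also have "dist x (x + (\<tau> * s) *\<^sub>R axis k 1) = \<tau>" using s that by (simp add: dist_norm abs_mult)
    finally show ?thesis using x that by simp
  qed
  have "q 0 \<le> q t"
  proof (rule DERIV_nonneg_imp_nondecreasing[OF t])
    fix \<tau> assume \<tau>: "0 \<le> \<tau>" "\<tau> \<le> t"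
    have dif: "\<rho> differentiable at (x + (\<tau> * s) *\<^sub>R axis k 1)"
      using C2_differentiable(1)[OF \<rho> U(1)] in_ball[OF \<tau>] U(2) by blast
    have "((\<lambda>\<tau>. \<tau> * s) has_real_derivative s) (at \<tau>)"
      by (auto intro!: derivative_eq_intros)
    from DERIV_chain2[where f = "\<lambda>t. \<rho> (x + t *\<^sub>R axis k 1)", OF DERIV_along_axis[OF dif] this]
    have "((\<lambda>\<tau>. \<rho> (x + (\<tau> * s) *\<^sub>R axis k 1)) has_real_derivative
        partial_deriv k \<rho> (x + (\<tau> * s) *\<^sub>R axis k 1) * s) (at \<tau>)" .
    then have "(q has_real_derivative partial_deriv k \<rho> (x + (\<tau> * s) *\<^sub>R axis k 1) * s - a) (at \<tau>)"
      unfolding q_def[abs_def] by (auto intro!: derivative_eq_intros)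
    then show "\<exists>y. (q has_real_derivative y) (at \<tau>) \<and> 0 \<le> y"
      using lower[OF in_ball[OF \<tau>]] by (auto simp: mult.commute)
  qed
  then show ?thesis by (simp add: q_def)
qed

text \<open>A substitute for the distance to the boundary which is of class \<open>C\<^sup>2\<close> on the whole space. On \<open>N\<close> it
  dominates a multiple of the distance, so that its small sublevel sets lie in thin boundary strips.
  These conditions survive the addition of barriers for different sets \<open>N\<close>; a lower bound for the gradient
  would not.\<close>

definition is_barrier_near :: "(real^'n::finite) set \<Rightarrow> (real^'n \<Rightarrow> real) \<Rightarrow> (real^'n) set \<Rightarrow> bool" where
  "is_barrier_near \<Omega> \<psi> N \<longleftrightarrow> Ck_on 2 \<psi> UNIV \<and> (\<forall>x\<in>\<Omega>. 0 \<le> \<psi> x) \<and> (\<forall>x\<in>frontier \<Omega>. \<psi> x = 0) \<and>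
     (\<exists>c>0. \<forall>x\<in>\<Omega> \<inter> N. c * infdist x (frontier \<Omega>) \<le> \<psi> x)"

text \<open>Away from the boundary any bump will do, since the distance is bounded on a bounded set.\<close>

lemma barrier_near_interior_point:
  assumes "bounded \<Omega>" "frontier \<Omega> \<noteq> {}" "open \<Omega>" "p \<in> \<Omega>"
  obtains \<psi> r where "r > 0" "is_barrier_near \<Omega> \<psi> (ball p r)"
proof -
  obtain R where R: "R > 0" "ball p R \<subseteq> \<Omega>" using assms(3,4) open_contains_ball by blast
  obtain z where z: "z \<in> frontier \<Omega>" using assms(2) by blast
  have "bounded (insert z \<Omega>)" using assms(1) by simp
  then obtain D where D: "\<And>x. x \<in> \<Omega> \<Longrightarrow> dist z x \<le> D" unfolding bounded_any_center[of _ z] by auto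
  obtain c where c: "c > 0" "\<And>x. dist p x \<le> R / 2 \<Longrightarrow> c \<le> bump p R x"
    using bump_lower_bound[OF R(1), where p = p] by blast
  have low: "c / (\<bar>D\<bar> + 1) * infdist x (frontier \<Omega>) \<le> bump p R x" if x: "x \<in> \<Omega>" "x \<in> ball p (R/2)" for x
  proof -
    have "infdist x (frontier \<Omega>) \<le> \<bar>D\<bar> + 1"
      using infdist_le[OF z, of x] D[OF x(1)] by (simp add: dist_commute)
    then have "c / (\<bar>D\<bar> + 1) * infdist x (frontier \<Omega>) \<le> c / (\<bar>D\<bar> + 1) * (\<bar>D\<bar> + 1)"
      using c(1) by (intro mult_left_mono) auto
    also have "\<dots> = c" by simp
    also have "c \<le> bump p R x" using c(2) x(2) by simp
    finally show ?thesis .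
  qed
  show ?thesis
  proof (rule that[of "R / 2" "bump p R"])
    have "bump p R x = 0" if "x \<in> frontier \<Omega>" for x
      using bump_eq_0_iff[OF R(1), of p x] R(2) that assms(3) by (auto simp: frontier_def interior_open)
    then show "is_barrier_near \<Omega> (bump p R) (ball p (R / 2))"
      unfolding is_barrier_near_def using bump_nonneg low c(1)
      by (auto simp: Ck_on_bump intro!: exI[of _ "c / (\<bar>D\<bar> + 1)"])
  qed (use R in simp)
qed

text \<open>The barrier is \<open>- \<rho>\<close>, localized by a bump. Moving from \<open>x \<in> \<Omega>\<close> along the axis on which \<open>\<rho>\<close> grows at rate
  at least \<open>a\<close>, one reaches \<open>\<rho> \<ge> 0\<close>, hence leaves \<open>\<Omega>\<close>, after a distance of at most \<open>- \<rho> x / a\<close>. Therefore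
  \<open>- \<rho>\<close> dominates \<open>a\<close> times the distance to the boundary.\<close>

lemma barrier_near_boundary_point:
  fixes \<Omega> :: "(real^'n::finite) set"
  assumes \<Omega>: "open \<Omega>" and p: "p \<in> frontier \<Omega>" and U: "open U" "p \<in> U" and \<rho>: "Ck_on 2 \<rho> U"
    and k: "partial_deriv k \<rho> p \<noteq> 0" and sub: "\<Omega> \<inter> U = {x\<in>U. \<rho> x < 0}"
  obtains \<psi> r where "r > 0" "is_barrier_near \<Omega> \<psi> (ball p r)"
proof -
  obtain s a R where s: "\<bar>s\<bar> = 1" and a: "a > 0" and R: "R > 0" "cball p R \<subseteq> U" and
    lower: "\<And>x. x \<in> cball p R \<Longrightarrow> s * partial_deriv k \<rho> x \<ge> a"
    using axis_derivative_lower_bound[OF \<rho> U k] by blast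
  have in_iff: "y \<in> \<Omega> \<longleftrightarrow> \<rho> y < 0" if "y \<in> U" for y using sub that by blast
  have c\<rho>: "continuous_on U \<rho>" by (rule Ck_on_imp_continuous_on[OF \<rho>])
  have \<rho>_frontier: "\<rho> x = 0" if x: "x \<in> frontier \<Omega>" "x \<in> U" for x
  proof (rule antisym)
    have "x \<notin> \<Omega>" using x(1) \<Omega> by (auto simp: frontier_def interior_open)
    then show "0 \<le> \<rho> x" using in_iff[OF x(2)] by simp
    show "\<rho> x \<le> 0"
    proof (rule ccontr)
      assume "\<not> \<rho> x \<le> 0"
      have "open (U \<inter> \<rho> -` {0<..})"
        using U(1) c\<rho> by (subst Int_commute) (simp add: continuous_on_open_vimage)
      moreover have "x \<in> U \<inter> \<rho> -` {0<..}" using x(2) \<open>\<not> \<rho> x \<le> 0\<close> by simp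
      moreover have "x \<in> closure \<Omega>" using x(1) by (simp add: frontier_def)
      ultimately obtain y where "y \<in> \<Omega>" "y \<in> U \<inter> \<rho> -` {0<..}"
        using open_Int_closure_eq_empty[of "U \<inter> \<rho> -` {0<..}" \<Omega>] by blast
      then show False using in_iff[of y] by simp
    qed
  qed
  \<comment> \<open>Where \<open>- \<rho> x < a * R / 2\<close>, a step of length \<open>- \<rho> x / a\<close> from a point \<open>x\<close> near \<open>p\<close> stays in \<open>cball p R\<close>.\<close>
  have "open (U \<inter> \<rho> -` {- (a * R / 2)<..})"
    using U(1) c\<rho> by (subst Int_commute) (simp add: continuous_on_open_vimage)
  moreover have "p \<in> U \<inter> \<rho> -` {- (a * R / 2)<..}" using U(2) \<rho>_frontier[OF p U(2)] a R(1) by simp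
  ultimately obtain r0 where r0: "r0 > 0" "ball p r0 \<subseteq> U \<inter> \<rho> -` {- (a * R / 2)<..}"
    using open_contains_ball by blast
  define r where "r = min r0 (R / 2)"
  have r: "r > 0" "r \<le> r0" "r \<le> R / 2" using r0 R by (auto simp: r_def)
  have dist_le: "a * infdist x (frontier \<Omega>) \<le> - \<rho> x" if x: "x \<in> \<Omega>" "x \<in> ball p r" for x
  proof -
    \<comment> \<open>By \<open>axis_growth\<close>, \<open>\<rho>\<close> is nonnegative after a step of length \<open>t\<close> along the axis.\<close>
    define t where "t = - \<rho> x / a"
    have "x \<in> ball p r0" using x(2) r(2) by simp
    then have xU: "x \<in> U" "\<rho> x > - (a * R / 2)" using r0(2) by blast+
    then have neg: "\<rho> x < 0" using in_iff x(1) by blast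
    have t: "t \<ge> 0" "t \<le> R / 2" using neg xU(2) a by (auto simp: t_def field_simps)
    have "dist p x + t \<le> R" using x(2) r(3) t by simp
    from axis_growth[OF \<rho> U(1) R(2) s lower this t(1)]
    have ge: "\<rho> (x + (t * s) *\<^sub>R axis k 1) \<ge> 0" using a by (simp add: t_def)
    have d: "dist x (x + (t * s) *\<^sub>R axis k 1) = t" using s t by (simp add: dist_norm abs_mult)
    have "dist p (x + (t * s) *\<^sub>R axis k 1) \<le> R"
      using dist_triangle[of p "x + (t * s) *\<^sub>R axis k 1" x] d \<open>dist p x + t \<le> R\<close> by linarith
    then have "x + (t * s) *\<^sub>R axis k 1 \<in> U" using R(2) by auto
    then have "x + (t * s) *\<^sub>R axis k 1 \<notin> \<Omega>" using ge in_iff by (meson not_le)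
    from infdist_frontier_le[OF \<Omega> x(1) this] have "infdist x (frontier \<Omega>) \<le> t" using d by simp
    then show ?thesis using a by (simp add: t_def field_simps)
  qed
  define \<psi> where "\<psi> x = bump p R x * (-1 * \<rho> x)" for x
  obtain c where c: "c > 0" "\<And>x. dist p x \<le> R / 2 \<Longrightarrow> c \<le> bump p R x"
    using bump_lower_bound[OF R(1), where p = p] by blast
  have C2: "Ck_on 2 \<psi> UNIV"
    unfolding \<psi>_def[abs_def] by (intro Ck_on_bump_mult[OF U(1) R(2,1)] Ck_on_mult Ck_on_const \<rho> U)
  have nonneg: "0 \<le> \<psi> x" if "x \<in> \<Omega>" for x
  proof (cases "x \<in> U")
    case True
    then have "\<rho> x < 0" using in_iff that by blast
    then show ?thesis using bump_nonneg[of p R x] by (simp add: \<psi>_def mult_nonneg_nonpos)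
  next
    case False
    then have "x \<notin> ball p R" using R(2) ball_subset_cball by blast
    then show ?thesis using bump_eq_0_iff[OF R(1), of p x] by (simp add: \<psi>_def)
  qed
  have zero: "\<psi> x = 0" if "x \<in> frontier \<Omega>" for x
  proof (cases "x \<in> U")
    case True
    then show ?thesis using \<rho>_frontier[OF that] by (simp add: \<psi>_def)
  next
    case False
    then have "x \<notin> ball p R" using R(2) ball_subset_cball by blast
    then show ?thesis using bump_eq_0_iff[OF R(1), of p x] by (simp add: \<psi>_def)
  qed
  have low: "c * a * infdist x (frontier \<Omega>) \<le> \<psi> x" if x: "x \<in> \<Omega>" "x \<in> ball p r" for x
  proof -
    have "c \<le> bump p R x" using c(2) x(2) r(3) by simp
    then have "c * (a * infdist x (frontier \<Omega>)) \<le> bump p R x * (- \<rho> x)"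
      using dist_le[OF x] a bump_nonneg[of p R x] by (intro mult_mono) (auto simp: infdist_nonneg)
    then show ?thesis by (simp add: \<psi>_def mult.assoc)
  qed
  show ?thesis
    by (rule that[OF r(1), of \<psi>], unfold is_barrier_near_def)
       (use C2 nonneg zero low c(1) a in \<open>auto intro!: exI[of _ "c * a"]\<close>)
qed

text \<open>Local barriers around finitely many points that cover the compact closure are added up; each is
  nonnegative on \<open>\<Omega>\<close>, so the sum inherits the lower bound of every one of them.\<close>

lemma exists_barrier:
  fixes \<Omega> :: "(real^'n::finite) set"
  assumes dom: "smooth_bounded_domain \<Omega>"
  obtains \<psi> where "is_barrier_near \<Omega> \<psi> \<Omega>"
proof -
  have \<Omega>: "open \<Omega>" "\<Omega> \<noteq> {}" "bounded \<Omega>" using dom by (auto simp: smooth_bounded_domain_def)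
  have fne: "frontier \<Omega> \<noteq> {}"
    using \<Omega> frontier_eq_empty[of \<Omega>] not_bounded_UNIV by auto
  have "\<exists>\<psi> r. r > 0 \<and> is_barrier_near \<Omega> \<psi> (ball p r)" if p: "p \<in> closure \<Omega>" for p
  proof (cases "p \<in> \<Omega>")
    case True
    then show ?thesis using barrier_near_interior_point[OF \<Omega>(3) fne \<Omega>(1) True] by blast
  next
    case False
    then have pf: "p \<in> frontier \<Omega>" using p \<Omega>(1) by (simp add: frontier_def interior_open)
    then obtain U \<rho> where U: "open U" "p \<in> U" and \<rho>: "\<forall>m. Ck_on m \<rho> U"
      and grad: "\<forall>x\<in>U. \<exists>k. partial_deriv k \<rho> x \<noteq> 0" and sub: "\<Omega> \<inter> U = {x\<in>U. \<rho> x < 0}"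
      using dom unfolding smooth_bounded_domain_def by blast
    obtain k where "partial_deriv k \<rho> p \<noteq> 0" using grad U(2) by blast
    from this show ?thesis using barrier_near_boundary_point[OF \<Omega>(1) pf U spec[OF \<rho>] \<open>partial_deriv k \<rho> p \<noteq> 0\<close> sub] by blast
  qed
  then have "\<exists>\<psi>r. \<forall>p\<in>closure \<Omega>. snd (\<psi>r p) > 0 \<and> is_barrier_near \<Omega> (fst (\<psi>r p)) (ball p (snd (\<psi>r p)))"
    by (intro bchoice) auto
  then obtain \<psi>r where \<psi>r: "\<And>p. p \<in> closure \<Omega> \<Longrightarrow> snd (\<psi>r p) > 0"
    "\<And>p. p \<in> closure \<Omega> \<Longrightarrow> is_barrier_near \<Omega> (fst (\<psi>r p)) (ball p (snd (\<psi>r p)))"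
    by blast
  define \<Psi> r where "\<Psi> p = fst (\<psi>r p)" and "r p = snd (\<psi>r p)" for p
  note r = \<psi>r(1)[folded r_def] and \<Psi> = \<psi>r(2)[folded r_def \<Psi>_def]
  have "compact (closure \<Omega>)" using \<Omega>(3) by (simp add: compact_closure)
  moreover have "closure \<Omega> \<subseteq> (\<Union>p\<in>closure \<Omega>. ball p (r p))" using r by auto
  ultimately obtain P where P: "P \<subseteq> closure \<Omega>" "finite P" "closure \<Omega> \<subseteq> (\<Union>p\<in>P. ball p (r p))"
    using compactE_image[of "closure \<Omega>" "closure \<Omega>" "\<lambda>p. ball p (r p)"] by (metis open_ball)
  have "\<exists>c>0. \<forall>x\<in>\<Omega> \<inter> ball p (r p). c * infdist x (frontier \<Omega>) \<le> \<Psi> p x" if "p \<in> P" for p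
    using \<Psi>[of p] that P(1) unfolding is_barrier_near_def by blast
  then have "\<exists>c. \<forall>p\<in>P. c p > 0 \<and> (\<forall>x\<in>\<Omega> \<inter> ball p (r p). c p * infdist x (frontier \<Omega>) \<le> \<Psi> p x)"
    by (intro bchoice) blast
  then obtain c where c: "\<And>p. p \<in> P \<Longrightarrow> c p > 0"
    "\<And>p x. p \<in> P \<Longrightarrow> x \<in> \<Omega> \<Longrightarrow> x \<in> ball p (r p) \<Longrightarrow> c p * infdist x (frontier \<Omega>) \<le> \<Psi> p x" 
    by blast
  have P0: "P \<noteq> {}" using P(3) \<Omega>(2) closure_subset[of \<Omega>] by auto
  define c0 where "c0 = Min (c ` P)"
  have c0: "c0 > 0" "\<And>p. p \<in> P \<Longrightarrow> c0 \<le> c p" using P(2) P0 c(1) by (auto simp: c0_def)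
  have nonneg: "0 \<le> \<Psi> p x" if "p \<in> P" "x \<in> \<Omega>" for p x
    using \<Psi>[of p] that P(1) unfolding is_barrier_near_def by blast
  have "is_barrier_near \<Omega> (\<lambda>x. \<Sum>p\<in>P. \<Psi> p x) \<Omega>"
    unfolding is_barrier_near_def
  proof (intro conjI ballI exI[of _ c0])
    show "Ck_on 2 (\<lambda>x. \<Sum>p\<in>P. \<Psi> p x) UNIV"
      using \<Psi> P(1) unfolding is_barrier_near_def by (intro Ck_on_sum) auto
    show "0 \<le> (\<Sum>p\<in>P. \<Psi> p x)" if "x \<in> \<Omega>" for x using nonneg that by (intro sum_nonneg) auto
    show "(\<Sum>p\<in>P. \<Psi> p x) = 0" if "x \<in> frontier \<Omega>" for x
      using \<Psi> P(1) that unfolding is_barrier_near_def by (intro sum.neutral) blast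
    fix x assume "x \<in> \<Omega> \<inter> \<Omega>"
    then have x: "x \<in> \<Omega>" by simp
    then obtain p where p: "p \<in> P" "x \<in> ball p (r p)" using P(3) closure_subset[of \<Omega>] by blast
    have "c0 * infdist x (frontier \<Omega>) \<le> c p * infdist x (frontier \<Omega>)"
      using c0(2)[OF p(1)] by (intro mult_right_mono) (auto simp: infdist_nonneg)
    also have "\<dots> \<le> \<Psi> p x" by (rule c(2)[OF p(1) x p(2)])
    also have "\<dots> \<le> (\<Sum>p\<in>P. \<Psi> p x)"
      by (rule member_le_sum[OF p(1) _ P(2)]) (use nonneg x in auto)
    finally show "c0 * infdist x (frontier \<Omega>) \<le> (\<Sum>p\<in>P. \<Psi> p x)" .
  qed (rule c0(1))
  then show ?thesis using that by blast
qed

section \<open>Cutoff profiles\<close>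

text \<open>A convex \<open>C\<^sup>2\<close> regularization of \<open>max 0 t\<close>, equal to it outside \<open>{-1..1}\<close>. It is a second difference of
  cubes, and its second derivative is the hat function, the second difference of \<open>max 0 t\<close>.\<close>

definition smooth_ramp :: "real \<Rightarrow> real" where
  "smooth_ramp t = (pos_cube (t + 1) - 2 * pos_cube t + pos_cube (t - 1)) / 6"

definition smooth_ramp' :: "real \<Rightarrow> real" where
  "smooth_ramp' t = ((max 0 (t + 1))\<^sup>2 - 2 * (max 0 t)\<^sup>2 + (max 0 (t - 1))\<^sup>2) / 2"

definition smooth_ramp'' :: "real \<Rightarrow> real" where
  "smooth_ramp'' t = max 0 (t + 1) - 2 * max 0 t + max 0 (t - 1)"

lemma DERIV_smooth_ramp: "(smooth_ramp has_real_derivative smooth_ramp' t) (at t)"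
proof -
  have "((\<lambda>t. pos_cube (t + c)) has_real_derivative 3 * (max 0 (t + c))\<^sup>2) (at t)" for c
  proof -
    have "((\<lambda>t. t + c) has_real_derivative 1) (at t)" by (auto intro!: derivative_eq_intros)
    from DERIV_chain2[OF DERIV_pos_cube this] show ?thesis by simp
  qed
  from this[of 1] this[of 0] this[of "-1"] show ?thesis
    unfolding smooth_ramp_def[abs_def] smooth_ramp'_def
    by (auto intro!: derivative_eq_intros)
qed

lemma DERIV_smooth_ramp': "(smooth_ramp' has_real_derivative smooth_ramp'' t) (at t)"
proof -
  have "((\<lambda>t. 3 * (max 0 (t + c))\<^sup>2) has_real_derivative 6 * max 0 (t + c)) (at t)" for c
  proof -
    have "((\<lambda>t. t + c) has_real_derivative 1) (at t)" by (auto intro!: derivative_eq_intros)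
    from DERIV_chain2[OF DERIV_pos_cube' this] show ?thesis by simp
  qed
  from DERIV_cmult[OF this, of "1/3"]
  have "((\<lambda>t. (max 0 (t + c))\<^sup>2) has_real_derivative 2 * max 0 (t + c)) (at t)" for c by simp
  note d = this
  from DERIV_cdivide[OF DERIV_add[OF DERIV_diff[OF d[of 1] DERIV_cmult[OF d[of 0], of 2]] d[of "-1"]], of 2]
  show ?thesis by (simp add: smooth_ramp'_def[abs_def] smooth_ramp''_def add_divide_distrib diff_divide_distrib)
qed

lemma smooth_ramp_cases:
  obtains "t \<le> -1" "smooth_ramp t = 0" "smooth_ramp' t = 0" "smooth_ramp'' t = 0"
  | "-1 \<le> t" "t \<le> 0" "smooth_ramp t = (t + 1) ^ 3 / 6" "smooth_ramp' t = (t + 1)\<^sup>2 / 2" "smooth_ramp'' t = t + 1"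
  | "0 \<le> t" "t \<le> 1" "smooth_ramp t = t + (1 - t) ^ 3 / 6" "smooth_ramp' t = 1 - (1 - t)\<^sup>2 / 2" "smooth_ramp'' t = 1 - t"
  | "1 \<le> t" "smooth_ramp t = t" "smooth_ramp' t = 1" "smooth_ramp'' t = 0"
proof -
  have e: "max 0 s = (if s \<le> 0 then 0 else s)" for s :: real by simp
  consider "t \<le> -1" | "-1 < t" "t \<le> 0" | "0 < t" "t \<le> 1" | "1 < t" by linarith
  then show ?thesis
  proof cases
    case 1
    then have "smooth_ramp t = 0" "smooth_ramp' t = 0" "smooth_ramp'' t = 0"
      by (simp_all add: smooth_ramp_def smooth_ramp'_def smooth_ramp''_def pos_cube_def e)
    with 1 show ?thesis using that(1) by blast
  next
    case 2
    then have "smooth_ramp t = (t + 1) ^ 3 / 6" "smooth_ramp' t = (t + 1)\<^sup>2 / 2" "smooth_ramp'' t = t + 1"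
      by (simp_all add: smooth_ramp_def smooth_ramp'_def smooth_ramp''_def pos_cube_def e)
    with 2 show ?thesis using that(2) by linarith
  next
    case 3
    then have "smooth_ramp t = t + (1 - t) ^ 3 / 6" "smooth_ramp' t = 1 - (1 - t)\<^sup>2 / 2" "smooth_ramp'' t = 1 - t"
      by (simp_all add: smooth_ramp_def smooth_ramp'_def smooth_ramp''_def pos_cube_def e field_simps power2_eq_square power3_eq_cube)
    with 3 show ?thesis using that(3) by linarith
  next
    case 4
    then have "smooth_ramp t = t" "smooth_ramp' t = 1" "smooth_ramp'' t = 0"
      by (simp_all add: smooth_ramp_def smooth_ramp'_def smooth_ramp''_def pos_cube_def e field_simps power2_eq_square power3_eq_cube)
    with 4 show ?thesis using that(4) by linarith
  qed
qed

lemma smooth_ramp_bounds: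
  "0 \<le> smooth_ramp t" "0 \<le> smooth_ramp' t" "smooth_ramp' t \<le> 1" "0 \<le> smooth_ramp'' t" "smooth_ramp'' t \<le> 1"
proof -
  have sq: "(1 - s)\<^sup>2 \<le> 1" if "0 \<le> s" "s \<le> 1" for s :: real
    using that by (simp add: abs_square_le_1)
  have sq': "(s + 1)\<^sup>2 \<le> 1" if "-1 \<le> s" "s \<le> 0" for s :: real
    using that by (simp add: abs_square_le_1)
  have *: "0 \<le> smooth_ramp t \<and> 0 \<le> smooth_ramp' t \<and> smooth_ramp' t \<le> 1 \<and> 0 \<le> smooth_ramp'' t \<and> smooth_ramp'' t \<le> 1"
  proof (cases t rule: smooth_ramp_cases)
    case 2
    show ?thesis using 2(1,2) sq'[of t] by (simp add: 2(3-5))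
  next
    case 3
    show ?thesis using 3(1,2) sq[of t] by (simp add: 3(3-5))
  qed auto
  then show "0 \<le> smooth_ramp t" "0 \<le> smooth_ramp' t" "smooth_ramp' t \<le> 1" "0 \<le> smooth_ramp'' t" "smooth_ramp'' t \<le> 1"
    by auto
qed

text \<open>The profile is \<open>F t = h (r t / b)\<close> with the concave function \<open>h s = 1 - (max 0 (1 - s))\<^sup>3\<close> and the convex
  function \<open>r t = a * smooth_ramp (t / a - 2)\<close>, which vanishes for \<open>t \<le> a\<close> and equals \<open>t - 2 * a\<close> for
  \<open>t \<ge> 3 * a\<close>. Two scales are essential. To vanish near zero, \<open>F\<close> has to be convex somewhere, which costs
  \<open>3 / (a * b)\<close> in the second derivative, but only for \<open>t \<le> 3 * a\<close>; at the larger scale \<open>b\<close> the second derivative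
  is nonpositive and the price is just \<open>3 / b\<close> in the first derivative.\<close>

lemma exists_cutoff_profile:
  fixes a b :: real
  assumes ab: "0 < a" "a \<le> b"
  obtains F F' F'' where
    "\<And>t. (F has_real_derivative F' t) (at t)" "\<And>t. (F' has_real_derivative F'' t) (at t)"
    "continuous_on UNIV F''"
    "\<And>t. 0 \<le> F t" "\<And>t. t \<le> a \<Longrightarrow> F t = 0" "\<And>t. 3 * b \<le> t \<Longrightarrow> F t = 1"
    "\<And>t. 0 \<le> F' t" "\<And>t. F' t \<le> 3 / b" "\<And>t. 3 * b \<le> t \<Longrightarrow> F' t = 0"
    "\<And>t. F'' t \<le> 3 / (a * b)" "\<And>t. 3 * a \<le> t \<Longrightarrow> F'' t \<le> 0"
proof -
  define r where "r t = a * smooth_ramp (t / a - 2)" for t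
  define r' where "r' t = smooth_ramp' (t / a - 2)" for t
  define r'' where "r'' t = smooth_ramp'' (t / a - 2) / a" for t
  define m where "m t = max 0 (1 - r t / b)" for t
  define F where "F t = 1 - pos_cube (1 - r t / b)" for t
  define F' where "F' t = 3 * (m t)\<^sup>2 * (r' t / b)" for t
  define F'' where "F'' t = 3 * (m t)\<^sup>2 * (r'' t / b) - 6 * m t * (r' t / b)\<^sup>2" for t
  have b: "b > 0" using ab by simp
  have inner: "((\<lambda>t. t / a - 2) has_real_derivative 1 / a) (at t)" for t
    using ab by (auto intro!: derivative_eq_intros)
  have dr: "(r has_real_derivative r' t) (at t)" for t
    using DERIV_cmult[OF DERIV_chain2[OF DERIV_smooth_ramp inner[of t]], of a] ab(1)
    by (simp add: r_def[abs_def] r'_def)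
  have dr': "(r' has_real_derivative r'' t) (at t)" for t
    using DERIV_chain2[OF DERIV_smooth_ramp' inner[of t]] by (simp add: r'_def[abs_def] r''_def)
  have inner2: "((\<lambda>t. 1 - r t / b) has_real_derivative - (r' t / b)) (at t)" for t
    using b by (auto intro!: derivative_eq_intros dr)
  have dF: "(F has_real_derivative F' t) (at t)" for t
    using DERIV_diff[OF DERIV_const DERIV_chain2[OF DERIV_pos_cube inner2[of t]], of 1]
    by (simp add: F_def[abs_def] F'_def m_def)
  have dm: "((\<lambda>t. 3 * (m t)\<^sup>2) has_real_derivative 6 * m t * - (r' t / b)) (at t)" for t
    using DERIV_chain2[OF DERIV_pos_cube' inner2[of t]] by (simp add: m_def)
  have drb: "((\<lambda>t. r' t / b) has_real_derivative r'' t / b) (at t)" for t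
    by (rule DERIV_cdivide[OF dr'])
  have dF': "(F' has_real_derivative F'' t) (at t)" for t
  proof -
    have "F'' t = 6 * m t * - (r' t / b) * (r' t / b) + r'' t / b * (3 * (m t)\<^sup>2)"
      by (simp add: F''_def power2_eq_square ac_simps)
    then show ?thesis using DERIV_mult[OF dm[of t] drb[of t]] by (simp add: F'_def[abs_def])
  qed
  have cr: "continuous_on UNIV r" "continuous_on UNIV r'"
    by (rule DERIV_continuous_on, rule has_field_derivative_at_within, rule dr dr')+
  have inner_cont: "continuous_on UNIV (\<lambda>t. t / a - 2)" using ab by (intro continuous_intros) auto
  have cr'': "continuous_on UNIV r''"
    unfolding r''_def[abs_def] smooth_ramp''_def
    using ab by (intro continuous_on_divide continuous_on_add continuous_on_diff continuous_on_mult
        continuous_on_max continuous_on_const inner_cont) simp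
  have rb: "continuous_on UNIV (\<lambda>t. r t / b)" "continuous_on UNIV (\<lambda>t. r' t / b)" "continuous_on UNIV (\<lambda>t. r'' t / b)"
    using b cr cr'' by (simp_all add: continuous_on_divide continuous_on_const)
  have cF'': "continuous_on UNIV F''"
    unfolding F''_def[abs_def] m_def
    by (intro continuous_on_diff continuous_on_mult continuous_on_power continuous_on_max continuous_on_const rb)
  have r_nonneg: "0 \<le> r t" and r'_bounds: "0 \<le> r' t" "r' t \<le> 1" and r''_bounds: "0 \<le> r'' t" "r'' t \<le> 1 / a" for t
    using smooth_ramp_bounds[of "t / a - 2"] ab by (auto simp: r_def r'_def r''_def divide_right_mono)
  have m: "0 \<le> m t" "m t \<le> 1" for t using r_nonneg[of t] b by (auto simp: m_def)
  then have m2: "0 \<le> (m t)\<^sup>2" "(m t)\<^sup>2 \<le> 1" for t by (auto simp: power_le_one)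
  have F0: "0 \<le> F t" for t
    using pos_cube_mono[of "1 - r t / b" 1] r_nonneg[of t] b by (simp add: F_def pos_cube_def)
  have small: "F t = 0" if "t \<le> a" for t
  proof -
    have "t / a - 2 \<le> -1" using that ab by (simp add: field_simps)
    then have "r t = 0" by (cases "t / a - 2" rule: smooth_ramp_cases) (auto simp: r_def)
    then show ?thesis by (simp add: F_def pos_cube_def)
  qed
  have large: "r t = t - 2 * a" "r'' t = 0" if "3 * a \<le> t" for t
  proof -
    have "1 \<le> t / a - 2" using that ab by (simp add: field_simps)
    then show "r t = t - 2 * a" "r'' t = 0" using ab
      by (cases "t / a - 2" rule: smooth_ramp_cases; auto simp: r_def r''_def field_simps)+
  qed
  \<comment> \<open>Since \<open>a \<le> b\<close>, here \<open>r t = t - 2 * a \<ge> b\<close>.\<close>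
  have m_large: "1 - r t / b \<le> 0" if "3 * b \<le> t" for t
    using large(1)[of t] that ab b by (simp add: field_simps)
  show ?thesis
  proof (rule that[OF dF dF' cF'' F0 small])
    show "F t = 1" "F' t = 0" if "3 * b \<le> t" for t
      using m_large[OF that] by (simp_all add: F_def F'_def m_def pos_cube_eq_0_iff)
    show "0 \<le> F' t" for t using r'_bounds[of t] b by (simp add: F'_def)
    show "F' t \<le> 3 / b" for t
    proof -
      have "3 * (m t)\<^sup>2 * (r' t / b) \<le> 3 * 1 * (1 / b)"
        using m2[of t] r'_bounds[of t] b by (intro mult_mono divide_right_mono) auto
      then show ?thesis by (simp add: F'_def)
    qed
    have le: "F'' t \<le> 3 * (m t)\<^sup>2 * (r'' t / b)" for t
      using m[of t] by (simp add: F''_def)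
    show "F'' t \<le> 3 / (a * b)" for t
    proof -
      have "3 * (m t)\<^sup>2 * (r'' t / b) \<le> 3 * 1 * ((1 / a) / b)"
        using m2[of t] r''_bounds[of t] b by (intro mult_mono divide_right_mono) auto
      with le[of t] show ?thesis by (simp add: mult.commute)
    qed
    show "F'' t \<le> 0" if "3 * a \<le> t" for t
      using le[of t] large(2)[OF that] by simp
  qed
qed

text \<open>The extension by zero is of class \<open>C\<^sup>2\<close> on \<open>U\<close> and on the complement of \<open>S\<close>, and these open sets cover the
  space.\<close>

lemma is_test_function_extend:
  assumes U: "open U" and f: "Ck_on 2 f U" and S: "compact S" "S \<subseteq> U" "\<And>x. x \<in> U \<Longrightarrow> x \<notin> S \<Longrightarrow> f x = 0"
  shows "is_test_function U (\<lambda>x. if x \<in> U then f x else 0)" (is "is_test_function U ?g")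
proof -
  have 1: "Ck_on 2 ?g U" by (rule Ck_on_cong_imp[OF U _ f]) simp
  have 2: "Ck_on 2 ?g (- S)"
    by (rule Ck_on_cong_imp[of _ "\<lambda>x. 0"]) (use S in \<open>auto simp: compact_imp_closed open_Compl intro: Ck_on_const\<close>)
  have "U \<union> - S = UNIV" using S(2) by auto
  then have "Ck_on 2 ?g UNIV"
    using Ck_on_Un[OF U _ 1 2] S(1) by (simp add: compact_imp_closed open_Compl)
  moreover have sub: "{x. ?g x \<noteq> 0} \<subseteq> S" using S(3) by auto
  then have "closure {x. ?g x \<noteq> 0} \<subseteq> S" using S(1) by (intro closure_minimal compact_imp_closed)
  ultimately show ?thesis
    using bounded_subset[OF compact_imp_bounded[OF S(1)] sub] S(2) by (auto simp: is_test_function_def)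
qed

lemma partial_deriv_paraboloid:
  "partial_deriv k (\<lambda>x::real^'n::finite. M - (norm x)\<^sup>2) = (\<lambda>x. - 2 * x $ k)"
proof
  fix x :: "real^'n"
  have "((\<lambda>x. M - x \<bullet> x) has_derivative (\<lambda>h. - (x \<bullet> h + h \<bullet> x))) (at x)"
    by (auto intro!: derivative_eq_intros)
  then show "partial_deriv k (\<lambda>x. M - (norm x)\<^sup>2) x = - 2 * x $ k"
    using partial_deriv_eqI by (fastforce simp: power2_norm_eq_inner inner_axis inner_commute)
qed

lemma laplacian_paraboloid:
  "laplacian (\<lambda>x::real^'n::finite. M - (norm x)\<^sup>2) x = - 2 * real CARD('n)"
proof -
  have "partial_deriv k (\<lambda>x::real^'n. - 2 * x $ k) x = - 2" for k
  proof -
    have "((\<lambda>x::real^'n. x $ k) has_derivative (\<lambda>h. h $ k)) (at x)"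
      by (rule bounded_linear_imp_has_derivative[OF bounded_linear_vec_nth])
    from partial_deriv_eqI[OF has_derivative_mult_right[OF this, of "- 2"]] show ?thesis by simp
  qed
  then show ?thesis by (simp add: laplacian_def partial_deriv_paraboloid)
qed

lemma Ck_on_paraboloid: "open U \<Longrightarrow> Ck_on m (\<lambda>x::real^'n::finite. M - (norm x)\<^sup>2) U"
proof -
  assume U: "open U"
  have "Ck_on m (\<lambda>x::real^'n. M + (- 1) * (norm (x - 0))\<^sup>2) U"
    by (intro Ck_on_add Ck_on_mult Ck_on_const Ck_on_norm_sq U)
  then show ?thesis by simp
qed

section \<open>Subharmonic functions with zero trace\<close>

text \<open>Test with \<open>Q * F (\<psi>)\<close>, where \<open>Q x = R\<^sup>2 - \<bar>x\<bar>\<^sup>2\<close> is nonnegative on \<open>\<Omega>\<close> with Laplacian \<open>- N\<close>, \<open>\<psi>\<close> is a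
  barrier and \<open>F\<close> is the profile with scales \<open>a \<le> b\<close>. Expanding the Laplacian and estimating each term by
  the bounds on \<open>F\<close> yields
  \<open>N * \<integral>u \<le> (N * b + D1) * (m b / b) + D2 / b * (m a / a)\<close>, where \<open>m t\<close> is the integral of \<open>u\<close> over the strip
  \<open>\<psi> \<le> 3 * t\<close>. The trace condition says \<open>m t / t \<rightarrow> 0\<close>, so letting first \<open>a\<close> and then \<open>b\<close> tend to zero gives
  \<open>\<integral>u \<le> 0\<close>. The term with \<open>F''\<close> has the order \<open>m b / b\<^sup>2\<close> in absolute value, which the trace condition does
  not control; it is harmless because \<open>F\<close> is concave beyond the scale \<open>a\<close>.\<close>

lemma subharmonic_zero_trace_imp_zero:
  fixes u :: "real^'n::finite \<Rightarrow> real"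
  assumes dom: "smooth_bounded_domain \<Omega>"
    and u: "integrable lborel u" "\<And>x. 0 \<le> u x" "\<And>x. x \<notin> \<Omega> \<Longrightarrow> u x = 0"
    and sub: "\<And>\<phi>. is_test_function \<Omega> \<phi> \<Longrightarrow> (\<And>x. 0 \<le> \<phi> x) \<Longrightarrow> 0 \<le> (\<integral>x. u x * laplacian \<phi> x \<partial>lborel)"
    and trace: "((\<lambda>\<epsilon>. 1 / \<epsilon> * (\<integral>x. indicator {x\<in>\<Omega>. infdist x (frontier \<Omega>) \<le> \<epsilon>} x * u x \<partial>lborel)) \<longlongrightarrow> 0) (at_right 0)"
  shows "AE x in lborel. u x = 0"
proof -
  have \<Omega>: "open \<Omega>" "\<Omega> \<noteq> {}" "bounded \<Omega>" using dom by (auto simp: smooth_bounded_domain_def)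
  obtain \<psi> where "is_barrier_near \<Omega> \<psi> \<Omega>" using exists_barrier[OF dom] by blast
  then obtain c where \<psi>: "Ck_on 2 \<psi> UNIV" "\<And>x. x \<in> \<Omega> \<Longrightarrow> 0 \<le> \<psi> x" "\<And>x. x \<in> frontier \<Omega> \<Longrightarrow> \<psi> x = 0"
    and c: "c > 0" "\<And>x. x \<in> \<Omega> \<Longrightarrow> c * infdist x (frontier \<Omega>) \<le> \<psi> x"
    unfolding is_barrier_near_def by auto
  note c\<psi> = C2_continuous[OF \<psi>(1)]
  have [measurable]: "\<Omega> \<in> sets borel" using \<Omega>(1) by simp
  have [measurable]: "\<psi> \<in> borel_measurable borel" by (rule borel_measurable_continuous_onI[OF c\<psi>(1)])
  have [measurable]: "u \<in> borel_measurable borel" using u(1) by simp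
  have [measurable]: "(\<lambda>x. infdist x (frontier \<Omega>)) \<in> borel_measurable borel"
    by (intro borel_measurable_continuous_onI continuous_intros)
  define N where "N = 2 * real CARD('n)"
  have N: "N > 0" by (simp add: N_def)
  obtain R where R: "\<And>x. x \<in> \<Omega> \<Longrightarrow> norm x \<le> R" using \<Omega>(3) by (auto simp: bounded_iff)
  define Q where "Q x = R\<^sup>2 - (norm x)\<^sup>2" for x :: "real^'n"
  have Q0: "0 \<le> Q x" if "x \<in> \<Omega>" for x using R[OF that] by (simp add: Q_def power_mono)
  have CQ: "Ck_on 2 Q UNIV" unfolding Q_def[abs_def] by (rule Ck_on_paraboloid) simp
  have lapQ: "laplacian Q x = - N" for x unfolding Q_def[abs_def] laplacian_paraboloid N_def by simp
  note cQ = C2_continuous[OF CQ]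
  define g1 where "g1 x = 2 * (\<Sum>k\<in>UNIV. partial_deriv k Q x * partial_deriv k \<psi> x) + Q x * laplacian \<psi> x" for x
  define g2 where "g2 x = Q x * (\<Sum>k\<in>UNIV. (partial_deriv k \<psi> x)\<^sup>2)" for x
  have bound_on_\<Omega>: "\<exists>A\<ge>0. \<forall>x\<in>\<Omega>. g x \<le> A" if "continuous_on UNIV g" for g :: "real^'n \<Rightarrow> real"
  proof -
    have "compact (g ` closure \<Omega>)"
      using that \<Omega>(3) by (intro compact_continuous_image) (auto intro: continuous_on_subset simp: compact_closure)
    then obtain A where "A > 0" "\<And>y. y \<in> g ` closure \<Omega> \<Longrightarrow> norm y \<le> A"
      using compact_imp_bounded bounded_pos by metis
    then show ?thesis using closure_subset[of \<Omega>] by (intro exI[of _ A]) force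
  qed
  have "continuous_on UNIV g1" unfolding g1_def[abs_def] by (intro continuous_intros c\<psi> cQ)
  then obtain A1 where A1: "A1 \<ge> 0" "\<And>x. x \<in> \<Omega> \<Longrightarrow> g1 x \<le> A1" using bound_on_\<Omega> by blast
  have "continuous_on UNIV g2" unfolding g2_def[abs_def] by (intro continuous_intros c\<psi> cQ)
  then obtain A2 where A2: "A2 \<ge> 0" "\<And>x. x \<in> \<Omega> \<Longrightarrow> g2 x \<le> A2" using bound_on_\<Omega> by blast
  have g2_0: "0 \<le> g2 x" if "x \<in> \<Omega>" for x
    unfolding g2_def using Q0[OF that] by (intro mult_nonneg_nonneg sum_nonneg) auto
  define D1 where "D1 = 3 * A1"
  define D2 where "D2 = 3 * A2"
  have D: "D1 \<ge> 0" "D2 \<ge> 0" using A1 A2 by (auto simp: D1_def D2_def)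
  define S where "S t = {x\<in>\<Omega>. \<psi> x \<le> 3 * t}" for t
  have [measurable]: "S t \<in> sets borel" for t unfolding S_def by measurable
  define m where "m t = (\<integral>x. indicator (S t) x * u x \<partial>lborel)" for t
  have i_ind: "integrable lborel (\<lambda>x. indicator T x * u x)" if [measurable]: "T \<in> sets borel" for T
    using integrable_bounded_mult[OF u(1), of "indicator T" 1] by (simp add: mult.commute indicator_def)
  have key: "N * (\<integral>x. u x \<partial>lborel) \<le> (N + D1 / b) * m b + D2 / (a * b) * m a" if ab: "0 < a" "a \<le> b" for a b
  proof -
    have b: "b > 0" using ab by simp
    obtain F F' F'' where F: "\<And>t. (F has_real_derivative F' t) (at t)" "\<And>t. (F' has_real_derivative F'' t) (at t)"
      "continuous_on UNIV F''"
      and F0: "\<And>t. 0 \<le> F t" "\<And>t. t \<le> a \<Longrightarrow> F t = 0" "\<And>t. 3 * b \<le> t \<Longrightarrow> F t = 1"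
      and F1: "\<And>t. 0 \<le> F' t" "\<And>t. F' t \<le> 3 / b" "\<And>t. 3 * b \<le> t \<Longrightarrow> F' t = 0"
      and F2: "\<And>t. F'' t \<le> 3 / (a * b)" "\<And>t. 3 * a \<le> t \<Longrightarrow> F'' t \<le> 0"
      using exists_cutoff_profile[OF ab] by blast
    define f where "f x = Q x * F (\<psi> x)" for x
    have CF: "Ck_on 2 (\<lambda>x. F (\<psi> x)) UNIV" by (rule Ck_on_2_compose[OF open_UNIV \<psi>(1) F])
    have Cf: "Ck_on 2 f UNIV" unfolding f_def[abs_def] by (rule Ck_on_mult[OF open_UNIV CQ CF])
    define T where "T = closure \<Omega> \<inter> {x. a \<le> \<psi> x}"
    have T: "compact T" unfolding T_def
      using \<Omega>(3) by (intro compact_Int_closed closed_Collect_le c\<psi>) (auto simp: compact_closure)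
    have "T \<subseteq> \<Omega>" using \<psi>(3) ab \<Omega>(1) unfolding T_def frontier_def by (force simp: interior_open)
    moreover have "f x = 0" if "x \<in> \<Omega>" "x \<notin> T" for x
      using that closure_subset[of \<Omega>] F0(2)[of "\<psi> x"] by (auto simp: T_def f_def)
    ultimately have test: "is_test_function \<Omega> (\<lambda>x. if x \<in> \<Omega> then f x else 0)" (is "is_test_function \<Omega> ?f")
      by (intro is_test_function_extend[OF \<Omega>(1) Ck_on_subset[OF Cf] T]) auto
    have lap: "laplacian ?f x = - N * F (\<psi> x) + F' (\<psi> x) * g1 x + F'' (\<psi> x) * g2 x" if "x \<in> \<Omega>" for x
    proof -
      have "laplacian ?f x = laplacian f x" by (rule laplacian_cong[OF \<Omega>(1) _ that]) simp
      also have "\<dots> = Q x * laplacian (\<lambda>x. F (\<psi> x)) x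
          + 2 * (\<Sum>k\<in>UNIV. partial_deriv k Q x * partial_deriv k (\<lambda>x. F (\<psi> x)) x) + F (\<psi> x) * laplacian Q x"
        unfolding f_def[abs_def] by (rule laplacian_mult[OF open_UNIV CQ CF]) simp
      also have "(\<Sum>k\<in>UNIV. partial_deriv k Q x * partial_deriv k (\<lambda>x. F (\<psi> x)) x)
          = F' (\<psi> x) * (\<Sum>k\<in>UNIV. partial_deriv k Q x * partial_deriv k \<psi> x)"
        unfolding sum_distrib_left
        by (intro sum.cong refl) (simp add: partial_deriv_compose[OF C2_differentiable(1)[OF \<psi>(1) open_UNIV UNIV_I] F(1)])
      also have "laplacian (\<lambda>x. F (\<psi> x)) x = F' (\<psi> x) * laplacian \<psi> x + F'' (\<psi> x) * (\<Sum>k\<in>UNIV. (partial_deriv k \<psi> x)\<^sup>2)"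
        by (rule laplacian_compose[OF open_UNIV \<psi>(1) UNIV_I F(1,2)])
      finally show ?thesis by (simp add: g1_def g2_def lapQ algebra_simps)
    qed
    \<comment> \<open>For \<open>\<psi> x \<le> 3 * b\<close> the first term is only known to be nonpositive, whence the summand \<open>N\<close> there.\<close>
    have lap_le: "laplacian ?f x \<le> - N + (N + D1 / b) * indicator (S b) x + D2 / (a * b) * indicator (S a) x" if x: "x \<in> \<Omega>" for x
    proof -
      have "- N * F (\<psi> x) \<le> - N + N * indicator (S b) x"
        using F0(1)[of "\<psi> x"] F0(3)[of "\<psi> x"] N x by (auto simp: S_def indicator_def)
      moreover have "F' (\<psi> x) * g1 x \<le> D1 / b * indicator (S b) x"
      proof (cases "\<psi> x \<le> 3 * b")
        case True
        have "F' (\<psi> x) * g1 x \<le> F' (\<psi> x) * A1" using A1(2)[OF x] F1(1) by (intro mult_left_mono) auto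
        also have "\<dots> \<le> 3 / b * A1" using A1(1) F1(2) by (intro mult_right_mono) auto
        finally show ?thesis using True x by (simp add: S_def D1_def)
      next
        case False
        then show ?thesis using F1(3)[of "\<psi> x"] by (simp add: S_def)
      qed
      moreover have "F'' (\<psi> x) * g2 x \<le> D2 / (a * b) * indicator (S a) x"
      proof (cases "\<psi> x \<le> 3 * a")
        case True
        have "F'' (\<psi> x) * g2 x \<le> 3 / (a * b) * g2 x" using F2(1) g2_0[OF x] by (intro mult_right_mono) auto
        also have "\<dots> \<le> 3 / (a * b) * A2" using A2(2)[OF x] ab b by (intro mult_left_mono) auto
        finally show ?thesis using True x by (simp add: S_def D2_def)
      next
        case False
        then show ?thesis using F2(2)[of "\<psi> x"] g2_0[OF x] by (simp add: S_def mult_nonpos_nonneg)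
      qed
      ultimately show ?thesis unfolding lap[OF x] by (simp add: algebra_simps)
    qed
    note test_D = is_test_functionD[OF test]
    have cl: "continuous_on UNIV (laplacian ?f)" by (rule C2_continuous(4)[OF test_D(1)])
    obtain L where L: "\<And>x. \<bar>laplacian ?f x\<bar> \<le> L"
      using bounded_of_bounded_support[OF cl bounded_support_derivatives(3)[OF test_D(2)]] by blast
    have "0 \<le> (\<integral>x. u x * laplacian ?f x \<partial>lborel)"
      using Q0 F0(1) by (intro sub[OF test]) (auto simp: f_def)
    also have "\<dots> \<le> (\<integral>x. - N * u x + (N + D1 / b) * (indicator (S b) x * u x) + D2 / (a * b) * (indicator (S a) x * u x) \<partial>lborel)"
    proof (rule integral_mono)
      show "integrable lborel (\<lambda>x. u x * laplacian ?f x)"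
        by (rule integrable_bounded_mult[OF u(1) _ L]) (simp add: borel_measurable_continuous_onI[OF cl])
      show "integrable lborel (\<lambda>x. - N * u x + (N + D1 / b) * (indicator (S b) x * u x) + D2 / (a * b) * (indicator (S a) x * u x))"
        using u(1) i_ind by (intro Bochner_Integration.integrable_add integrable_mult_right) auto
      show "u x * laplacian ?f x \<le> - N * u x + (N + D1 / b) * (indicator (S b) x * u x) + D2 / (a * b) * (indicator (S a) x * u x)" for x
      proof (cases "x \<in> \<Omega>")
        case True
        from mult_left_mono[OF lap_le[OF True] u(2)[of x]] show ?thesis by (simp add: algebra_simps)
      qed (simp add: u(3))
    qed
    also have "\<dots> = - N * (\<integral>x. u x \<partial>lborel) + (N + D1 / b) * m b + D2 / (a * b) * m a"
      using u(1) i_ind by (simp add: m_def del: integral_indicator)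
    finally show ?thesis by simp
  qed
  have m0: "0 \<le> m t" for t unfolding m_def using u(2) by (intro integral_nonneg_AE) auto
  define d where "d \<epsilon> = (\<integral>x. indicator {x\<in>\<Omega>. infdist x (frontier \<Omega>) \<le> \<epsilon>} x * u x \<partial>lborel)" for \<epsilon>
  have md: "m t \<le> d (3 / c * t)" for t
    unfolding m_def d_def
  proof (rule integral_mono[OF i_ind i_ind])
    show "indicator (S t) x * u x \<le> indicator {x\<in>\<Omega>. infdist x (frontier \<Omega>) \<le> 3 / c * t} x * u x" for x
    proof (rule mult_right_mono[OF _ u(2)])
      have "infdist x (frontier \<Omega>) \<le> 3 / c * t" if "x \<in> S t"
        using c(2)[of x] that c(1) by (auto simp: S_def field_simps)
      then show "indicator (S t) x \<le> (indicator {x\<in>\<Omega>. infdist x (frontier \<Omega>) \<le> 3 / c * t} x :: real)"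
        by (auto simp: indicator_def S_def)
    qed
  qed measurable
  have "filterlim (\<lambda>t. 3 / c * t) (at_right 0) (at_right 0)"
    using c(1) by (intro filterlim_times_pos[OF filterlim_ident]) auto
  from filterlim_compose[OF trace[folded d_def] this]
  have "((\<lambda>t. 3 / c * (1 / (3 / c * t) * d (3 / c * t))) \<longlongrightarrow> 3 / c * 0) (at_right 0)"
    by (intro tendsto_mult tendsto_const)
  then have lim_d: "((\<lambda>t. d (3 / c * t) / t) \<longlongrightarrow> 0) (at_right 0)" using c(1) by simp
  have lim_m: "((\<lambda>t. m t / t) \<longlongrightarrow> 0) (at_right 0)"
  proof (rule tendsto_sandwich[OF _ _ tendsto_const lim_d])
    show "\<forall>\<^sub>F t in at_right 0. 0 \<le> m t / t"
      using m0 by (auto simp: eventually_at_right_field intro!: exI[of _ 1])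
    show "\<forall>\<^sub>F t in at_right 0. m t / t \<le> d (3 / c * t) / t"
      using md by (auto simp: eventually_at_right_field divide_right_mono intro!: exI[of _ 1])
  qed
  \<comment> \<open>The limit \<open>a \<rightarrow> 0\<close> with \<open>b\<close> fixed.\<close>
  have one_scale: "N * (\<integral>x. u x \<partial>lborel) \<le> (N * b + D1) * (m b / b)" if "b > 0" for b
  proof -
    have "((\<lambda>a. (N + D1 / b) * m b + D2 / b * (m a / a)) \<longlongrightarrow> (N + D1 / b) * m b + D2 / b * 0) (at_right 0)"
      by (intro tendsto_intros lim_m)
    moreover have "\<forall>\<^sub>F a in at_right 0. N * (\<integral>x. u x \<partial>lborel) \<le> (N + D1 / b) * m b + D2 / b * (m a / a)"
      using key that by (auto simp: eventually_at_right_field mult.commute intro!: exI[of _ b])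
    ultimately have "N * (\<integral>x. u x \<partial>lborel) \<le> (N + D1 / b) * m b + D2 / b * 0"
      by (rule tendsto_lowerbound) simp
    then show ?thesis using that by (simp add: field_simps)
  qed
  have "((\<lambda>b. (N * b + D1) * (m b / b)) \<longlongrightarrow> (N * 0 + D1) * 0) (at_right 0)"
    by (intro tendsto_intros lim_m)
  moreover have "\<forall>\<^sub>F b in at_right 0. N * (\<integral>x. u x \<partial>lborel) \<le> (N * b + D1) * (m b / b)"
    using one_scale by (auto simp: eventually_at_right_field intro!: exI[of _ 1])
  ultimately have "N * (\<integral>x. u x \<partial>lborel) \<le> (N * 0 + D1) * 0"
    by (rule tendsto_lowerbound) simp
  then have "(\<integral>x. u x \<partial>lborel) \<le> 0" using N by (simp add: mult_le_0_iff)
  moreover have "0 \<le> (\<integral>x. u x \<partial>lborel)" using u(2) by (intro integral_nonneg_AE) auto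
  ultimately have "(\<integral>x. u x \<partial>lborel) = 0" by simp
  moreover have "AE x in lborel. 0 \<le> u x" using u(2) by simp
  ultimately show ?thesis using integral_nonneg_eq_0_iff_AE[OF u(1)] by blast
qed

section \<open>Uniqueness\<close>

lemma C2_c_imp_test_function:
  assumes "open U" "\<phi> \<in> C2_c U" "U \<subseteq> V"
  shows "is_test_function V \<phi>"
proof -
  have \<phi>: "Ck_on 2 \<phi> U" "compact (closure {x. \<phi> x \<noteq> 0})" "closure {x. \<phi> x \<noteq> 0} \<subseteq> U"
    using assms(2) by (auto simp: C2_c_def)
  have 2: "Ck_on 2 \<phi> (- closure {x. \<phi> x \<noteq> 0})"
    by (rule Ck_on_cong_imp[of _ "\<lambda>x. 0"])
       (use closure_subset[of "{x. \<phi> x \<noteq> 0}"] in \<open>auto intro: Ck_on_const\<close>)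
  have "U \<union> - closure {x. \<phi> x \<noteq> 0} = UNIV" using \<phi>(3) by auto
  then have "Ck_on 2 \<phi> UNIV" using Ck_on_Un[OF assms(1) open_Compl[OF closed_closure] \<phi>(1) 2] by simp
  moreover have "bounded {x. \<phi> x \<noteq> 0}"
    using compact_imp_bounded[OF \<phi>(2)] closure_subset bounded_subset by blast
  ultimately show ?thesis using \<phi>(3) assms(3) by (auto simp: is_test_function_def)
qed

lemma test_function_in_C2_0:
  assumes "open U" "is_test_function U \<phi>"
  shows "\<phi> \<in> C2_0 U"
proof -
  note \<phi> = is_test_functionD[OF assms(2)]
  note c = C2_continuous[OF \<phi>(1)]
  have ext: "extends_continuously_to_closure U g" if "continuous_on UNIV g" for g
    unfolding extends_continuously_to_closure_def
    using continuous_on_subset[OF that] by (intro exI[of _ g]) auto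
  have "\<phi> x = 0" if "x \<in> frontier U" for x
    using that \<phi>(4) closure_subset[of "{x. \<phi> x \<noteq> 0}"] assms(1) by (auto simp: frontier_def interior_open)
  then show ?thesis
    unfolding C2_0_def C2_closure_def
    using Ck_on_subset[OF \<phi>(1)] continuous_on_subset[OF c(1)] by (auto intro!: ext c(2,3))
qed

text \<open>Convolutions involve product measures, for which Borel functions are much more convenient than
  Lebesgue measurable ones; the extension by zero removes \<open>\<Omega>\<close> from the integrals.\<close>

lemma obtain_borel_extension:
  fixes w :: "'a::euclidean_space \<Rightarrow> real"
  assumes S: "S \<in> sets borel" and w: "w \<in> borel_measurable (lebesgue_on S)"
  obtains W where "W \<in> borel_measurable borel" "\<And>x. x \<notin> S \<Longrightarrow> W x = 0"
    "AE x in lebesgue. indicator S x * w x = W x"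
proof -
  have "S \<in> sets lebesgue" using S by simp
  then have "(\<lambda>x. indicator S x *\<^sub>R w x) \<in> borel_measurable lebesgue"
    using w by (subst (asm) borel_measurable_restrict_space_iff) auto
  then obtain W where W: "W \<in> borel_measurable lborel" "AE x in lborel. indicator S x *\<^sub>R w x = W x"
    using completion_ex_borel_measurable_real[of "\<lambda>x. indicator S x *\<^sub>R w x" lborel] by blast
  have [measurable]: "W \<in> borel_measurable borel" "S \<in> sets borel" using W(1) S by simp_all
  have "AE x in lborel. indicator S x * w x = indicator S x * W x"
    using W(2) by eventually_elim (auto simp: indicator_def)
  then have "AE x in lebesgue. indicator S x * w x = indicator S x * W x"
    by (rule AE_completion)
  then show ?thesis by (intro that[of "\<lambda>x. indicator S x * W x"]) auto
qed

lemma lebesgue_on_borel_extension: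
  fixes w W k :: "'a::euclidean_space \<Rightarrow> real"
  assumes S: "S \<in> sets borel" and w: "w \<in> borel_measurable (lebesgue_on S)"
    and W: "W \<in> borel_measurable borel" "AE x in lebesgue. indicator S x * w x = W x"
    and k: "k \<in> borel_measurable borel"
  shows "integrable (lebesgue_on S) (\<lambda>x. w x * k x) \<longleftrightarrow> integrable lborel (\<lambda>x. W x * k x)"
    and "(LINT x|lebesgue_on S. w x * k x) = (\<integral>x. W x * k x \<partial>lborel)"
proof -
  have S': "S \<inter> space lebesgue \<in> sets lebesgue" using S by simp
  have [measurable]: "W \<in> borel_measurable borel" "k \<in> borel_measurable borel" by fact+
  have m1: "(\<lambda>x. indicator S x *\<^sub>R w x) \<in> borel_measurable lebesgue"
    using w S by (subst (asm) borel_measurable_restrict_space_iff) auto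
  have kL: "k \<in> borel_measurable lebesgue" by (rule measurable_completion) simp
  have "(\<lambda>x. (indicator S x *\<^sub>R w x) * k x) \<in> borel_measurable lebesgue"
    using m1 kL by (rule borel_measurable_times)
  then have m: "(\<lambda>x. indicator S x *\<^sub>R (w x * k x)) \<in> borel_measurable lebesgue" by (simp add: mult.assoc)
  have mW: "(\<lambda>x. W x * k x) \<in> borel_measurable lborel" by simp
  then have mW': "(\<lambda>x. W x * k x) \<in> borel_measurable lebesgue" by (rule measurable_completion)
  have AE: "AE x in lebesgue. indicator S x *\<^sub>R (w x * k x) = W x * k x"
    using W(2) by eventually_elim (metis mult.assoc real_scaleR_def)
  show "integrable (lebesgue_on S) (\<lambda>x. w x * k x) \<longleftrightarrow> integrable lborel (\<lambda>x. W x * k x)"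
    using integrable_cong_AE[OF m mW' AE] integrable_completion[OF mW] integrable_restrict_space[OF S', of "\<lambda>x. w x * k x"] by simp
  show "(LINT x|lebesgue_on S. w x * k x) = (\<integral>x. W x * k x \<partial>lborel)"
    using integral_cong_AE[OF m mW' AE] integral_completion[OF mW] integral_restrict_space[OF S', of "\<lambda>x. w x * k x"] by simp
qed

text \<open>The inequality \<open>ennreal (enn2real v) \<le> v\<close> holds for infinite \<open>v\<close> as well.\<close>

lemma L1_V_integrable:
  assumes "potential \<Omega> V" "w \<in> L1_V \<Omega> V"
  shows "integrable (lebesgue_on \<Omega>) (\<lambda>x. w x * enn2real (V x))"
proof (rule integrableI_bounded)
  have [measurable]: "V \<in> borel_measurable (lebesgue_on \<Omega>)" "w \<in> borel_measurable (lebesgue_on \<Omega>)"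
    using assms by (auto simp: potential_def L1_V_def)
  show "(\<lambda>x. w x * enn2real (V x)) \<in> borel_measurable (lebesgue_on \<Omega>)" by measurable
  have "ennreal (norm (w x * enn2real (V x))) \<le> ennreal \<bar>w x\<bar> * V x" for x
  proof -
    have "ennreal (enn2real (V x)) \<le> V x" by (cases "V x") auto
    then show ?thesis by (simp add: abs_mult ennreal_mult mult_left_mono)
  qed
  then have "(\<integral>\<^sup>+x. ennreal (norm (w x * enn2real (V x))) \<partial>lebesgue_on \<Omega>)
    \<le> (\<integral>\<^sup>+x. ennreal \<bar>w x\<bar> * V x \<partial>lebesgue_on \<Omega>)" by (intro nn_integral_mono)
  also have "\<dots> < \<infinity>" using assms(2) by (simp add: L1_V_def)
  finally show "(\<integral>\<^sup>+x. ennreal (norm (w x * enn2real (V x))) \<partial>lebesgue_on \<Omega>) < \<infinity>" .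
qed

theorem corollary7p1:
  fixes \<Omega> K :: "(real^'n::finite) set"
    and V :: "real^'n \<Rightarrow> ennreal"
    and w :: "real^'n \<Rightarrow> real"
  assumes "smooth_bounded_domain \<Omega>"
    and "potential \<Omega> V"
    and "compact K" and "K \<subseteq> \<Omega>"
    and "weakly_dense \<Omega> V (C2_c (\<Omega> - K))"
    and "w \<in> L1_V \<Omega> V \<inter> L1_0 \<Omega>"
    and "\<And>\<phi>. \<phi> \<in> C2_c (\<Omega> - K) \<Longrightarrow>
           (LINT x|lebesgue_on \<Omega>. w x * (- laplacian \<phi> x + enn2real (V x) * \<phi> x)) = 0"
  shows "AE x in lebesgue_on \<Omega>. w x = 0"
proof -
  have open\<Omega>: "open \<Omega>" using assms(1) by (simp add: smooth_bounded_domain_def)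
  then have \<Omega>B[measurable]: "\<Omega> \<in> sets borel" by simp
  have w: "w \<in> L1_V \<Omega> V" "w \<in> L1_0 \<Omega>" using assms(6) by auto
  define f where "f x = w x * enn2real (V x)" for x
  have iw: "integrable (lebesgue_on \<Omega>) w" using w(2) by (simp add: L1_0_def)
  have i_f: "integrable (lebesgue_on \<Omega>) f" unfolding f_def[abs_def] by (rule L1_V_integrable[OF assms(2) w(1)])
  note mw = borel_measurable_integrable[OF iw] and mf = borel_measurable_integrable[OF i_f]
  obtain W where W: "W \<in> borel_measurable borel" "\<And>x. x \<notin> \<Omega> \<Longrightarrow> W x = 0"
    "AE x in lebesgue. indicator \<Omega> x * w x = W x"
    using obtain_borel_extension[OF \<Omega>B mw] by blast
  obtain F where F: "F \<in> borel_measurable borel" "\<And>x. x \<notin> \<Omega> \<Longrightarrow> F x = 0"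
    "AE x in lebesgue. indicator \<Omega> x * f x = F x"
    using obtain_borel_extension[OF \<Omega>B mf] by blast
  note wW = lebesgue_on_borel_extension[OF \<Omega>B mw W(1,3)]
  note fF = lebesgue_on_borel_extension[OF \<Omega>B mf F(1,3)]
  have iW: "integrable lborel W" using wW(1)[of "\<lambda>x. 1"] iw by simp
  have iF: "integrable lborel F" using fF(1)[of "\<lambda>x. 1"] i_f by simp
  have AEb: "AE x in lborel. indicator \<Omega> x * w x = W x" "AE x in lborel. indicator \<Omega> x * f x = F x"
    using W(3) F(3) by (simp_all add: AE_completion_iff)
  \<comment> \<open>Weak density transfers the equation from \<open>C2_c (\<Omega> - K)\<close> to all test functions on \<open>\<Omega>\<close>.\<close>
  have weak_eq: "(\<integral>x. W x * laplacian \<psi> x \<partial>lborel) = (\<integral>x. F x * \<psi> x \<partial>lborel)"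
    if \<psi>: "is_test_function \<Omega> \<psi>" for \<psi>
  proof -
    \<comment> \<open>Separate integrability of the two terms, needed to split the integral in the equation for \<open>w\<close>.\<close>
    have reduce: "integrable (lebesgue_on \<Omega>) (\<lambda>x. w x * laplacian \<phi> x) \<and> integrable (lebesgue_on \<Omega>) (\<lambda>x. f x * \<phi> x)
       \<and> (LINT x|lebesgue_on \<Omega>. w x * laplacian \<phi> x) = (\<integral>x. W x * laplacian \<phi> x \<partial>lborel)
       \<and> (LINT x|lebesgue_on \<Omega>. w x * \<phi> x * enn2real (V x)) = (\<integral>x. F x * \<phi> x \<partial>lborel)"
      if \<phi>: "is_test_function \<Omega> \<phi>" for \<phi>
    proof -
      note \<phi>D = is_test_functionD[OF \<phi>]
      note c = C2_continuous[OF \<phi>D(1)]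
      have m: "\<phi> \<in> borel_measurable borel" "laplacian \<phi> \<in> borel_measurable borel"
        using c(1,4) by (auto intro: borel_measurable_continuous_onI)
      obtain C where C: "\<And>x. \<bar>\<phi> x\<bar> \<le> C" using bounded_of_bounded_support[OF c(1) \<phi>D(2)] by blast
      obtain L where L: "\<And>x. \<bar>laplacian \<phi> x\<bar> \<le> L"
        using bounded_of_bounded_support[OF c(4) bounded_support_derivatives(3)[OF \<phi>D(2)]] by blast
      have "integrable lborel (\<lambda>x. W x * laplacian \<phi> x)" "integrable lborel (\<lambda>x. F x * \<phi> x)"
        using integrable_bounded_mult[OF iW _ L] integrable_bounded_mult[OF iF _ C] m by simp_all
      moreover have "(\<lambda>x. w x * \<phi> x * enn2real (V x)) = (\<lambda>x. f x * \<phi> x)" by (simp add: f_def fun_eq_iff)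
      ultimately show ?thesis using wW[OF m(2)] fF[OF m(1)] by simp
    qed
    obtain \<phi> where \<phi>: "\<And>j. \<phi> j \<in> C2_c (\<Omega> - K)" "weakly_converges \<Omega> V \<phi> \<psi>"
      using assms(5) test_function_in_C2_0[OF open\<Omega> \<psi>] unfolding weakly_dense_def by blast
    have "open (\<Omega> - K)" using open\<Omega> assms(3) by (simp add: compact_imp_closed open_Diff)
    from C2_c_imp_test_function[OF this \<phi>(1)] have test: "is_test_function \<Omega> (\<phi> j)" for j by blast
    have lim: "(\<lambda>j. LINT x|lebesgue_on \<Omega>. w x * \<phi> j x * enn2real (V x))
        \<longlonglongrightarrow> (LINT x|lebesgue_on \<Omega>. w x * \<psi> x * enn2real (V x))"
      "(\<lambda>j. LINT x|lebesgue_on \<Omega>. w x * laplacian (\<phi> j) x) \<longlonglongrightarrow> (LINT x|lebesgue_on \<Omega>. w x * laplacian \<psi> x)"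
      using \<phi>(2) assms(6) unfolding weakly_converges_def by blast+
    have "(LINT x|lebesgue_on \<Omega>. w x * laplacian (\<phi> j) x) = (LINT x|lebesgue_on \<Omega>. w x * \<phi> j x * enn2real (V x))" for j
    proof -
      have "0 = (LINT x|lebesgue_on \<Omega>. w x * (- laplacian (\<phi> j) x + enn2real (V x) * \<phi> j x))"
        using assms(7)[OF \<phi>(1)] by simp
      also have "\<dots> = (LINT x|lebesgue_on \<Omega>. f x * \<phi> j x - w x * laplacian (\<phi> j) x)"
        by (intro Bochner_Integration.integral_cong) (simp_all add: f_def algebra_simps)
      also have "\<dots> = (LINT x|lebesgue_on \<Omega>. f x * \<phi> j x) - (LINT x|lebesgue_on \<Omega>. w x * laplacian (\<phi> j) x)"
        using reduce[OF test] by (intro Bochner_Integration.integral_diff) blast+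
      also have "(LINT x|lebesgue_on \<Omega>. f x * \<phi> j x) = (LINT x|lebesgue_on \<Omega>. w x * \<phi> j x * enn2real (V x))"
        by (simp add: f_def mult.commute mult.left_commute)
      finally show ?thesis by simp
    qed
    then have "(LINT x|lebesgue_on \<Omega>. w x * laplacian \<psi> x) = (LINT x|lebesgue_on \<Omega>. w x * \<psi> x * enn2real (V x))"
      using LIMSEQ_unique[OF lim(1)] lim(2) by simp
    then show ?thesis using reduce[OF \<psi>] by simp
  qed
  have sign: "AE x in lborel. 0 \<le> W x * F x" and zero: "AE x in lborel. W x = 0 \<longrightarrow> F x = 0"
  proof -
    show "AE x in lborel. 0 \<le> W x * F x"
      using AEb
    proof eventually_elim
      case (elim x)
      have "W x * F x = (indicator \<Omega> x * w x)\<^sup>2 * enn2real (V x)"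
        unfolding elim[symmetric] f_def by (simp add: power2_eq_square indicator_def)
      then show ?case by simp
    qed
    show "AE x in lborel. W x = 0 \<longrightarrow> F x = 0"
      using AEb
    proof eventually_elim
      case (elim x)
      have "F x = W x * enn2real (V x)" unfolding elim[symmetric] f_def by simp
      then show ?case by simp
    qed
  qed
  have kato: "0 \<le> (\<integral>x. \<bar>W x\<bar> * laplacian \<phi> x \<partial>lborel)"
    if "is_test_function \<Omega> \<phi>" "\<And>x. 0 \<le> \<phi> x" for \<phi>
    by (rule kato_inequality[OF open\<Omega> iW iF weak_eq sign zero that])
  have trace: "(LINT x|lebesgue_on {x\<in>\<Omega>. infdist x (frontier \<Omega>) \<le> \<epsilon>}. \<bar>w x\<bar>)
      = (\<integral>x. indicator {x\<in>\<Omega>. infdist x (frontier \<Omega>) \<le> \<epsilon>} x * \<bar>W x\<bar> \<partial>lborel)" for \<epsilon>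
  proof -
    define S where "S = {x\<in>\<Omega>. infdist x (frontier \<Omega>) \<le> \<epsilon>}"
    have [measurable]: "(\<lambda>x. infdist x (frontier \<Omega>)) \<in> borel_measurable borel"
      by (intro borel_measurable_continuous_onI continuous_intros)
    have S: "S \<in> sets borel" unfolding S_def by measurable
    have "S \<subseteq> \<Omega>" by (auto simp: S_def)
    have AE: "AE x in lebesgue. indicator S x * \<bar>w x\<bar> = indicator S x * \<bar>W x\<bar>"
      using W(3)
    proof eventually_elim
      case (elim x)
      then show ?case using \<open>S \<subseteq> \<Omega>\<close> by (cases "x \<in> S") auto
    qed
    have "w \<in> borel_measurable (lebesgue_on S)"
      using mw \<open>S \<subseteq> \<Omega>\<close> by (rule measurable_restrict_mono)
    then have "(\<lambda>x. \<bar>w x\<bar>) \<in> borel_measurable (lebesgue_on S)" by simp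
    from lebesgue_on_borel_extension(2)[OF S this _ AE, of "\<lambda>x. 1"] S W(1) show ?thesis by (simp add: S_def)
  qed
  have "AE x in lborel. \<bar>W x\<bar> = 0"
  proof (rule subharmonic_zero_trace_imp_zero[OF assms(1)])
    show "((\<lambda>\<epsilon>. 1 / \<epsilon> * (\<integral>x. indicator {x\<in>\<Omega>. infdist x (frontier \<Omega>) \<le> \<epsilon>} x * \<bar>W x\<bar> \<partial>lborel)) \<longlongrightarrow> 0) (at_right 0)"
      using conjunct2[OF w(2)[unfolded L1_0_def mem_Collect_eq]] unfolding trace .
  qed (use iW W(2) kato in auto)
  then have "AE x in lebesgue. W x = 0" by (simp add: AE_completion_iff)
  with W(3) have "AE x in lebesgue. x \<in> \<Omega> \<longrightarrow> w x = 0"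
    by eventually_elim (auto simp: indicator_def)
  then show ?thesis by (subst AE_restrict_space_iff) auto
qed

end
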